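(* Consider the finite volume scheme $$\frac{d}{dt}\boldsymbol U_i=-\frac{\mathcal F_{i+1/2}-\mathcal F_{i-1/2}}{\Delta x}+\boldsymbol S_i$$ with source term $$\boldsymbol S_i=\begin{pmatrix}\boldsymbol 0\\ -\frac{g}{2\Delta x}\left(\mathcal P(\overline{\boldsymbol h}_{i+1/2})[\![\boldsymbol B]\!]_{i+1/2}+\mathcal P(\overline{\boldsymbol h}_{i-1/2})[\![\boldsymbol B]\!]_{i-1/2}\right)\end{pmatrix}$$ and diffusive numerical flux $$\mathcal F_{i+1/2}=\mathcal F^{EC}_{i+1/2}-\tfrac12\,\boldsymbol Q^{ES1}_{i+1/2}[\![\boldsymbol V]\!]_{i+1/2},\qquad \boldsymbol Q^{ES1}_{i+1/2}=\boldsymbol T_{i+1/2}|\boldsymbol\Lambda_{i+1/2}|\boldsymbol T_{i+1/2}^\top ,$$ where $\boldsymbol T_{i+1/2}\boldsymbol\Lambda_{i+1/2}\boldsymbol T_{i+1/2}^{-1}$ is the eigendecomposition of the flux Jacobian $\frac{\partial\widehat F}{\partial\widehat U}$ at the Roe-type average state $\widetilde{\boldsymbol U}_{i+1/2}=\left(\overline{\boldsymbol h}_{i+1/2}^\top,\ (\mathcal P(\overline{\boldsymbol h}_{i+1/2})\overline{\boldsymbol u}_{i+1/2})^\top\right)^\top$. The resulting scheme is a first-order, well-balanced energy stable (ES) scheme.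
   Context: Polynomial chaos setting. Let $\xi\in\mathbb R^d$ be a random variable with Lebesgue density $\rho$ having finite polynomial moments of all orders, and let $\phi_1,\dots,\phi_K$ (with $\phi_1\equiv1$) be polynomials, orthonormal for $\langle f,g\rangle_\rho=\int f g\rho$. For $\widehat z\in\mathbb R^K$ define the symmetric matrix $\mathcal P(\widehat z)=\sum_{k=1}^K\widehat z_k\mathcal M_k\in\mathbb R^{K\times K}$, $(\mathcal M_k)_{\ell,m}=\langle\phi_k,\phi_\ell\phi_m\rangle_\rho$. SGSWE. With constant $g>0$, state $\widehat U=(\widehat h^\top,\widehat q^\top)^\top\in\mathbb R^{2K}$, time-independent bottom coefficients $\widehat B(x)\in\mathbb R^K$ and $\widehat u=\mathcal P(\widehat h)^{-1}\widehat q$, the system is $\widehat U_t+(\widehat F(\widehat U))_x=\widehat S(\widehat U)$ with $$\widehat F(\widehat U)=\begin{pmatrix}\widehat q\\ \mathcal P(\widehat q)\mathcal P(\widehat h)^{-1}\widehat q+\tfrac12 g\mathcal P(\widehat h)\widehat h\end{pmatrix},\qquad \widehat S(\widehat U)=\begin{pmatrix}0\\-g\mathcal P(\widehat h)\widehat{B_x}\end{pmatrix}.$$ Discretization. Uniform mesh with cells $\mathcal I_i=[x_{i-1/2},x_{i+1/2}]$ of length $\Delta x$ and centers $x_i$. Unknowns $\boldsymbol U_i(t)=(\boldsymbol h_i^\top,\boldsymbol q_i^\top)^\top\in\mathbb R^{2K}$ approximate cell averages; $\boldsymbol B_i\in\mathbb R^K$ are (time-independent) discrete bottom values. Assume $\mathcal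 P(\boldsymbol h_i)$ is positive definite for all $i$; set $\boldsymbol u_i=\mathcal P(\boldsymbol h_i)^{-1}\boldsymbol q_i$. For a cell quantity $\boldsymbol a_i$: $\overline{\boldsymbol a}_{i+1/2}=\frac12(\boldsymbol a_i+\boldsymbol a_{i+1})$, $[\![\boldsymbol a]\!]_{i+1/2}=\boldsymbol a_{i+1}-\boldsymbol a_i$. Boundary treatment is not specified; statements are for cells whose neighbors are available (e.g. infinite or periodic mesh). Energy conservative flux: $$\mathcal F^{EC}_{i+1/2}=\begin{pmatrix}\mathcal P(\overline{\boldsymbol h}_{i+1/2})\overline{\boldsymbol u}_{i+1/2}\\ \frac g2\overline{(\mathcal P(\boldsymbol h)\boldsymbol h)}_{i+1/2}+\mathcal P(\overline{\boldsymbol u}_{i+1/2})\mathcal P(\overline{\boldsymbol h}_{i+1/2})\overline{\boldsymbol u}_{i+1/2}\end{pmatrix}.$$ Discrete energy and entropy variable: $$\boldsymbol E_i=\tfrac12(\boldsymbol q_i^\top\boldsymbol u_i+g\|\boldsymbol h_i\|^2)+g\boldsymbol h_i^\top\boldsymbol B_i,\qquad \boldsymbol V_i=\left(\frac{\partial\boldsymbol E_i}{\partial\boldsymbol U_i}\right)^{\top}=\begin{pmatrix}-\frac12\mathcal P(\boldsymbol u_i)\boldsymbol u_i+g(\boldsymbol h_i+\boldsymbol B_i)\\ \boldsymbol u_i\end{pmatrix}.$$ Eigenvector normalization. With $\overline h=\overline{\boldsymbol h}_{i+1/2}$, $\overline u=\overline{\boldsymbol u}_{i+1/2}$, $\widetilde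 q=\mathcal P(\overline h)\overline u$ and $G=\sqrt{g\mathcal P(\overline h)}$ (positive definite square root), let $$\boldsymbol R=\frac1{\sqrt{2g}}\begin{pmatrix}I&I\\ \mathcal P(\overline u)+G&\mathcal P(\overline u)-G\end{pmatrix},$$ $$\boldsymbol D=\frac12\begin{pmatrix}2G+\mathcal P(\overline u)+gG^{-1}\mathcal P(\widetilde q)G^{-1}&\mathcal P(\overline u)-gG^{-1}\mathcal P(\widetilde q)G^{-1}\\ \mathcal P(\overline u)-gG^{-1}\mathcal P(\widetilde q)G^{-1}&\mathcal P(\overline u)+gG^{-1}\mathcal P(\widetilde q)G^{-1}-2G\end{pmatrix}.$$ Then $\boldsymbol D$ is symmetric and $\frac{\partial\widehat F}{\partial\widehat U}(\widetilde{\boldsymbol U}_{i+1/2})=\boldsymbol R\boldsymbol D\boldsymbol R^{-1}$. With an orthogonal diagonalization $\boldsymbol D=\boldsymbol L\boldsymbol\Lambda\boldsymbol L^\top$, one takes $\boldsymbol T_{i+1/2}=\boldsymbol R\boldsymbol L$, $\boldsymbol\Lambda_{i+1/2}=\boldsymbol\Lambda$; $|\boldsymbol\Lambda|$ is the entrywise absolute value of the diagonal matrix. Energy stable (ES): solutions of the scheme satisfy $\frac{d}{dt}\boldsymbol E_i\le-\frac1{\Delta x}(\mathcal H_{i+1/2}-\mathcal H_{i-1/2})$ for all $i$, for some numerical entropy flux $\mathcal H_{i+1/2}$ at the interface $x_{i+1/2}$, i.e. a fixed function of the discrete states and bottom values in cells neighboring that interface. Well-balanced: if $\boldsymbol u_i=\boldsymbol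 0$ for all $i$ and $\boldsymbol h_i+\boldsymbol B_i$ is the same vector for all $i$, then $\frac{d}{dt}\boldsymbol h_i=\boldsymbol 0$ and $\frac{d}{dt}\boldsymbol q_i=\boldsymbol 0$ for all $i$. First-order: if $(\boldsymbol U_i,\boldsymbol B_i)$ are the exact cell averages of spatially smooth functions $(\widehat U,\widehat B)$ with $\mathcal P(\widehat h)>0$, then $\mathcal F_{i+1/2}-\widehat F(\widehat U)|_{x=x_{i+1/2}}=\mathcal O(\Delta x)$ and $\boldsymbol S_i-\widehat S(\widehat U)|_{x=x_i}=\mathcal O(\Delta x)$ as $\Delta x\to0$ (constants depending on the smooth functions, locally uniform in $x$). *)

theory Defs
  imports "HOL-Analysis.Analysis" "HOL-Probability.Probability"
begin

subsection \<open>Matrices and block vectors\<close>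

definition pos_def :: "real^'n^'n \<Rightarrow> bool" where
  "pos_def A \<longleftrightarrow> transpose A = A \<and> (\<forall>x. x \<noteq> 0 \<longrightarrow> x \<bullet> (A *v x) > 0)"

definition diagonal_mat :: "real^'n^'n \<Rightarrow> bool" where
  "diagonal_mat A \<longleftrightarrow> (\<forall>i j. i \<noteq> j \<longrightarrow> A $ i $ j = 0)"

definition abs_mat :: "real^'n^'n \<Rightarrow> real^'n^'n" where
  "abs_mat A = (\<chi> i j. \<bar>A $ i $ j\<bar>)"

text \<open>Vectors in $R^{2K}$ are indexed by the sum type \<open>'k + 'k\<close>: the \<open>Inl\<close> components form the
  upper half (water height) and the \<open>Inr\<close> components the lower half (discharge).\<close>

definition stack :: "real^'k \<Rightarrow> real^'k \<Rightarrow> real^('k + 'k)" where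
  "stack a b = (\<chi> i. case i of Inl k \<Rightarrow> a $ k | Inr k \<Rightarrow> b $ k)"

definition upper :: "real^('k + 'k) \<Rightarrow> real^'k" where
  "upper v = (\<chi> k. v $ Inl k)"

definition lower :: "real^('k + 'k) \<Rightarrow> real^'k" where
  "lower v = (\<chi> k. v $ Inr k)"

definition block_mat ::
  "real^'k^'k \<Rightarrow> real^'k^'k \<Rightarrow> real^'k^'k \<Rightarrow> real^'k^'k \<Rightarrow> real^('k + 'k)^('k + 'k)" where
  "block_mat A B C D = (\<chi> i j.
     case i of
       Inl k \<Rightarrow> (case j of Inl l \<Rightarrow> A $ k $ l | Inr l \<Rightarrow> B $ k $ l)
     | Inr k \<Rightarrow> (case j of Inl l \<Rightarrow> C $ k $ l | Inr l \<Rightarrow> D $ k $ l))"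

subsection \<open>Polynomial chaos\<close>

definition rho_inner :: "(real^'d \<Rightarrow> real) \<Rightarrow> (real^'d \<Rightarrow> real) \<Rightarrow> (real^'d \<Rightarrow> real) \<Rightarrow> real" where
  "rho_inner \<rho> f g = (\<integral>x. f x * g x * \<rho> x \<partial>lborel)"

text \<open>The number \<open>K\<close> of basis polynomials is the cardinality of the finite index type \<open>'k\<close>;
  \<open>k1\<close> is the index of the constant polynomial 1.\<close>

definition polynomial_chaos ::
  "'w measure \<Rightarrow> ('w \<Rightarrow> real^'d) \<Rightarrow> (real^'d \<Rightarrow> real) \<Rightarrow> ('k::finite \<Rightarrow> real^'d \<Rightarrow> real) \<Rightarrow> 'k \<Rightarrow> bool" where
  "polynomial_chaos M \<xi> \<rho> \<phi> k1 \<longleftrightarrow>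
     prob_space M \<and>
     \<rho> \<in> borel_measurable borel \<and> (\<forall>x. \<rho> x \<ge> 0) \<and>
     distributed M lborel \<xi> (\<lambda>x. ennreal (\<rho> x)) \<and>
     (\<forall>p. real_polynomial_function p \<longrightarrow> integrable lborel (\<lambda>x. p x * \<rho> x)) \<and>
     (\<forall>k. real_polynomial_function (\<phi> k)) \<and>
     \<phi> k1 = (\<lambda>x. 1) \<and>
     (\<forall>k l. rho_inner \<rho> (\<phi> k) (\<phi> l) = (if k = l then 1 else 0))"

definition triple_mat ::
  "(real^'d \<Rightarrow> real) \<Rightarrow> ('k::finite \<Rightarrow> real^'d \<Rightarrow> real) \<Rightarrow> 'k \<Rightarrow> real^'k^'k" where
  "triple_mat \<rho> \<phi> k = (\<chi> l m. rho_inner \<rho> (\<phi> k) (\<lambda>x. \<phi> l x * \<phi> m x))"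

definition chaos_mat ::
  "(real^'d \<Rightarrow> real) \<Rightarrow> ('k::finite \<Rightarrow> real^'d \<Rightarrow> real) \<Rightarrow> real^'k \<Rightarrow> real^'k^'k" where
  "chaos_mat \<rho> \<phi> z = (\<Sum>k\<in>UNIV. (z $ k) *\<^sub>R triple_mat \<rho> \<phi> k)"

subsection \<open>The stochastic Galerkin shallow water system\<close>

text \<open>From here on \<open>P\<close> stands for \<open>chaos_mat \<rho> \<phi>\<close>.\<close>

definition sgswe_flux ::
  "(real^'k \<Rightarrow> real^'k^'k) \<Rightarrow> real \<Rightarrow> real^('k + 'k) \<Rightarrow> real^('k + 'k)" where
  "sgswe_flux P g U =
     (let h = upper U; q = lower U in
      stack q (P q *v (matrix_inv (P h) *v q) + (g / 2) *\<^sub>R (P h *v h)))"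

definition sgswe_source ::
  "(real^'k \<Rightarrow> real^'k^'k) \<Rightarrow> real \<Rightarrow> real^('k + 'k) \<Rightarrow> real^'k \<Rightarrow> real^('k + 'k)" where
  "sgswe_source P g U Bx = stack 0 (- (g *\<^sub>R (P (upper U) *v Bx)))"

subsection \<open>Discrete quantities\<close>

text \<open>The data of one cell: the state $(h_i, q_i)$ together with the bottom value $B_i$.\<close>

type_synonym 'k cell = "(real^('k + 'k)) \<times> (real^'k)"

definition cell_h :: "'k::finite cell \<Rightarrow> real^'k" where
  "cell_h c = upper (fst c)"

definition cell_q :: "'k::finite cell \<Rightarrow> real^'k" where
  "cell_q c = lower (fst c)"

definition cell_B :: "'k::finite cell \<Rightarrow> real^'k" where
  "cell_B c = snd c"

definition cell_u :: "(real^'k \<Rightarrow> real^'k^'k) \<Rightarrow> 'k::finite cell \<Rightarrow> real^'k" where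
  "cell_u P c = matrix_inv (P (cell_h c)) *v cell_q c"

definition cell_energy :: "(real^'k \<Rightarrow> real^'k^'k) \<Rightarrow> real \<Rightarrow> 'k::finite cell \<Rightarrow> real" where
  "cell_energy P g c =
     (1 / 2) * (cell_q c \<bullet> cell_u P c + g * (norm (cell_h c))\<^sup>2) + g * (cell_h c \<bullet> cell_B c)"

definition entropy_var ::
  "(real^'k \<Rightarrow> real^'k^'k) \<Rightarrow> real \<Rightarrow> 'k::finite cell \<Rightarrow> real^('k + 'k)" where
  "entropy_var P g c =
     stack (- ((1 / 2) *\<^sub>R (P (cell_u P c) *v cell_u P c)) + g *\<^sub>R (cell_h c + cell_B c)) (cell_u P c)"

definition avg :: "real^'n \<Rightarrow> real^'n \<Rightarrow> real^'n" where
  "avg a b = (1 / 2) *\<^sub>R (a + b)"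

definition jump :: "real^'n \<Rightarrow> real^'n \<Rightarrow> real^'n" where
  "jump a b = b - a"

definition avg_h :: "'k::finite cell \<Rightarrow> 'k cell \<Rightarrow> real^'k" where
  "avg_h a b = avg (cell_h a) (cell_h b)"

definition avg_u :: "(real^'k \<Rightarrow> real^'k^'k) \<Rightarrow> 'k::finite cell \<Rightarrow> 'k cell \<Rightarrow> real^'k" where
  "avg_u P a b = avg (cell_u P a) (cell_u P b)"

subsection \<open>Normalized eigendecomposition at the Roe-type average\<close>

text \<open>In the next three definitions \<open>h\<close> and \<open>u\<close> are the interface averages and \<open>G\<close> is
  the positive definite square root of \<open>g *\<^sub>R P h\<close>.\<close>

definition roe_R ::
  "(real^'k \<Rightarrow> real^'k^'k) \<Rightarrow> real \<Rightarrow> real^'k \<Rightarrow> real^'k^'k \<Rightarrow> real^('k + 'k)^('k + 'k)" where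
  "roe_R P g u G = (1 / sqrt (2 * g)) *\<^sub>R block_mat (mat 1) (mat 1) (P u + G) (P u - G)"

definition roe_D ::
  "(real^'k \<Rightarrow> real^'k^'k) \<Rightarrow> real \<Rightarrow> real^'k \<Rightarrow> real^'k \<Rightarrow> real^'k^'k \<Rightarrow> real^('k + 'k)^('k + 'k)" where
  "roe_D P g h u G =
     (let A = g *\<^sub>R (matrix_inv G ** P (P h *v u) ** matrix_inv G) in
      (1 / 2) *\<^sub>R block_mat (2 *\<^sub>R G + P u + A) (P u - A) (P u - A) (P u + A - 2 *\<^sub>R G))"

text \<open>\<open>T ** \<Lambda> ** matrix_inv T\<close> is an eigendecomposition of the flux Jacobian at the Roe-type
  average state, with the eigenvectors normalized as \<open>T = R ** L\<close>.
  The clauses on the Jacobian and on the invertibility of \<open>T\<close> follow from the normalization;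
  see \<open>roe_eigendecompositionI\<close> below.\<close>

definition roe_eigendecomposition ::
  "(real^'k \<Rightarrow> real^'k^'k) \<Rightarrow> real \<Rightarrow> real^'k \<Rightarrow> real^'k
    \<Rightarrow> real^('k + 'k)^('k + 'k) \<Rightarrow> real^('k + 'k)^('k + 'k) \<Rightarrow> bool" where
  "roe_eigendecomposition P g h u T \<Lambda> \<longleftrightarrow>
     diagonal_mat \<Lambda> \<and> invertible T \<and>
     (sgswe_flux P g has_derivative (\<lambda>V. (T ** \<Lambda> ** matrix_inv T) *v V)) (at (stack h (P h *v u))) \<and>
     (\<exists>G L. pos_def G \<and> G ** G = g *\<^sub>R P h \<and>
        orthogonal_matrix L \<and> roe_D P g h u G = L ** \<Lambda> ** transpose L \<and>
        T = roe_R P g u G ** L)"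

subsection \<open>The normalized eigenvectors diagonalize the flux Jacobian\<close>

lemma chaos_mat_add: "chaos_mat \<rho> \<phi> (a + b) = chaos_mat \<rho> \<phi> a + chaos_mat \<rho> \<phi> b"
  by (simp add: chaos_mat_def scaleR_add_left sum.distrib)

lemma chaos_mat_scaleR: "chaos_mat \<rho> \<phi> (c *\<^sub>R a) = c *\<^sub>R chaos_mat \<rho> \<phi> a"
  by (simp add: chaos_mat_def scaleR_sum_right)

lemma chaos_mat_swap: "chaos_mat \<rho> \<phi> a *v b = chaos_mat \<rho> \<phi> b *v a"
proof -
  have sym: "rho_inner \<rho> (\<phi> k) (\<lambda>x. \<phi> l x * \<phi> m x) = rho_inner \<rho> (\<phi> m) (\<lambda>x. \<phi> l x * \<phi> k x)"
    for k l m by (simp add: rho_inner_def mult_ac)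
  have ent: "(chaos_mat \<rho> \<phi> z *v w) $ l
      = (\<Sum>m\<in>UNIV. \<Sum>k\<in>UNIV. (z $ k * w $ m) * rho_inner \<rho> (\<phi> k) (\<lambda>x. \<phi> l x * \<phi> m x))" for z w l
    by (simp add: matrix_vector_mult_def chaos_mat_def triple_mat_def sum_distrib_left
        sum_distrib_right mult_ac)
  have "(chaos_mat \<rho> \<phi> a *v b) $ l = (chaos_mat \<rho> \<phi> b *v a) $ l" for l
  proof -
    have "(chaos_mat \<rho> \<phi> a *v b) $ l
        = (\<Sum>k\<in>UNIV. \<Sum>m\<in>UNIV. (a $ k * b $ m) * rho_inner \<rho> (\<phi> k) (\<lambda>x. \<phi> l x * \<phi> m x))"
      unfolding ent by (rule sum.swap)
    also have "\<dots> = (chaos_mat \<rho> \<phi> b *v a) $ l"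
      unfolding ent by (intro sum.cong refl) (subst sym, simp)
    finally show ?thesis .
  qed
  then show ?thesis by (simp add: vec_eq_iff)
qed

lemma stack_upper_lower [simp]: "upper (stack a b) = a" "lower (stack a b) = b" "stack (upper v) (lower v) = v"
  by (auto simp: upper_def lower_def stack_def vec_eq_iff split: sum.splits)

lemma block_mat_stack:
  "block_mat A B C D *v stack a b = stack (A *v a + B *v b) (C *v a + D *v b)"
  by (auto simp: block_mat_def stack_def matrix_vector_mult_def vec_eq_iff UNIV_Plus_UNIV[symmetric]
      sum.Plus simp del: UNIV_Plus_UNIV split: sum.splits)

lemma stack_linear:
  "stack a b + stack c d = stack (a + c) (b + d)" "r *\<^sub>R stack a b = stack (r *\<^sub>R a) (r *\<^sub>R b)"
  by (auto simp: stack_def vec_eq_iff split: sum.splits)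

lemma upper_scaleR: "upper (c *\<^sub>R v) = c *\<^sub>R upper v"
  and lower_scaleR: "lower (c *\<^sub>R v) = c *\<^sub>R lower v"
  by (simp_all add: upper_def lower_def vec_eq_iff)

lemma bounded_linear_upper: "bounded_linear upper"
  by (auto simp: linear_conv_bounded_linear[symmetric] upper_def vec_eq_iff intro!: linearI)

lemma bounded_linear_lower: "bounded_linear lower"
  by (auto simp: linear_conv_bounded_linear[symmetric] lower_def vec_eq_iff intro!: linearI)

lemma pos_def_invertible: "pos_def A \<Longrightarrow> invertible A"
proof -
  assume A: "pos_def A"
  have "x = 0" if "A *v x = 0" for x
    using A that unfolding pos_def_def by fastforce
  then show ?thesis
    using invertible_left_inverse matrix_left_invertible_ker by blast
qed

lemma matrix_inv_mult_vec:
  assumes "invertible (A::real^'n^'n)"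
  shows "A *v (matrix_inv A *v x) = x" "matrix_inv A *v (A *v x) = x"
proof -
  have "A ** matrix_inv A = mat 1 \<and> matrix_inv A ** A = mat 1"
    using assms unfolding invertible_def matrix_inv_def by (rule someI_ex)
  then show "A *v (matrix_inv A *v x) = x" "matrix_inv A *v (A *v x) = x"
    by (simp_all add: matrix_vector_mul_assoc)
qed

lemma differentiable_prod:
  fixes f :: "'i \<Rightarrow> 'a::real_normed_vector \<Rightarrow> real"
  assumes "\<And>i. i \<in> I \<Longrightarrow> f i differentiable at x within S"
  shows "(\<lambda>x. \<Prod>i\<in>I. f i x) differentiable at x within S"
  using assms by (induction I rule: infinite_finite_induct) (auto intro: differentiable_mult)

lemma differentiable_det:
  fixes A :: "'a::real_normed_vector \<Rightarrow> real^'n^'n"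
  assumes "\<And>i j. (\<lambda>x. A x $ i $ j) differentiable at x within S"
  shows "(\<lambda>x. det (A x)) differentiable at x within S"
  unfolding det_def
  by (intro differentiable_sum ballI differentiable_mult differentiable_prod assms differentiable_const
      finite_permutations ) (simp add: finite_permutations)

lemma differentiable_matrix_inv_mult:
  fixes A :: "'a::real_normed_vector \<Rightarrow> real^'n^'n" and b :: "'a \<Rightarrow> real^'n"
  assumes A: "\<And>i j. (\<lambda>x. A x $ i $ j) differentiable at x0"
    and b: "\<And>i. (\<lambda>x. b x $ i) differentiable at x0"
    and inv: "invertible (A x0)"
  shows "(\<lambda>x. matrix_inv (A x) *v b x) differentiable at x0"
    and "\<forall>\<^sub>F x in nhds x0. invertible (A x)"
proof -
  have dd: "(\<lambda>x. det (A x)) differentiable at x0" by (rule differentiable_det[OF A])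
  have "isCont (\<lambda>x. det (A x)) x0" using dd by (rule differentiable_imp_continuous_within)
  moreover have "det (A x0) \<noteq> 0" using inv by (simp add: invertible_det_nz)
  ultimately have ev: "\<forall>\<^sub>F x in nhds x0. det (A x) \<noteq> 0"
    by (metis isCont_def tendsto_at_iff_tendsto_nhds tendsto_imp_eventually_ne)
  then show "\<forall>\<^sub>F x in nhds x0. invertible (A x)" by (simp add: invertible_det_nz)
  define N where "N = (\<lambda>x. \<chi> k. det (\<chi> i j. if j = k then b x $ i else A x $ i $ j) / det (A x))"
  have eq: "N x = matrix_inv (A x) *v b x" if "det (A x) \<noteq> 0" for x
  proof -
    have "A x *v (matrix_inv (A x) *v b x) = b x"
      using that by (simp add: matrix_inv_mult_vec invertible_det_nz)
    then show ?thesis using cramer[OF that] by (simp add: N_def)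
  qed
  have "(\<lambda>x. N x $ k) differentiable at x0" for k
    unfolding N_def using inv
    by (auto simp: invertible_det_nz intro!: differentiable_divide dd differentiable_det split: if_split)
       (case_tac "j = k"; simp add: A b)
  then have "N differentiable at x0"
    by (subst differentiable_componentwise_within) (auto simp: Basis_vec_def inner_axis)
  then obtain N' where "(N has_derivative N') (at x0)" by (auto simp: differentiable_def)
  then have "((\<lambda>x. matrix_inv (A x) *v b x) has_derivative N') (at x0)"
  proof (rule has_derivative_transform_eventually)
    show "\<forall>\<^sub>F x in at x0. N x = matrix_inv (A x) *v b x"
      using ev by (auto simp: eventually_at_filter eq elim: eventually_mono)
    show "N x0 = matrix_inv (A x0) *v b x0" using inv by (simp add: eq invertible_det_nz)
  qed simp
  then show "(\<lambda>x. matrix_inv (A x) *v b x) differentiable at x0" by (auto simp: differentiable_def)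
qed

lemma bounded_bilinear_chaos: "bounded_bilinear (\<lambda>a b. chaos_mat \<rho> \<phi> a *v b)"
  by (simp add: bilinear_conv_bounded_bilinear[symmetric])
    (auto simp: bilinear_def chaos_mat_add chaos_mat_scaleR matrix_vector_mult_add_rdistrib
      matrix_vector_right_distrib scaleR_matrix_vector_assoc matrix_vector_mult_scaleR intro!: linearI)

lemma sgswe_flux_has_derivative:
  fixes P :: "real^'k \<Rightarrow> real^'k^'k"
  assumes P: "P = chaos_mat \<rho> \<phi>" and h: "pos_def (P h)"
  shows "(sgswe_flux P g has_derivative
     (\<lambda>V. stack (lower V)
        (P u *v lower V + P (P h *v u) *v (matrix_inv (P h) *v (lower V - P u *v upper V))
          + g *\<^sub>R (P h *v upper V)))) (at (stack h (P h *v u)))"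
proof -
  let ?U = "stack h (P h *v u)"
  let ?N = "\<lambda>U. matrix_inv (P (upper U)) *v lower U"
  interpret P: bounded_bilinear "\<lambda>a b. P a *v b" unfolding P by (rule bounded_bilinear_chaos)
  note [derivative_intros] = P.FDERIV bounded_linear.has_derivative[OF bounded_linear_upper]
    bounded_linear.has_derivative[OF bounded_linear_lower]
  have hi: "invertible (P h)" using h by (rule pos_def_invertible)
  have up: "(\<lambda>U. upper U $ i) differentiable at x" and lo: "(\<lambda>U. lower U $ i) differentiable at x"
    for i and x :: "real^('k+'k)"
    unfolding upper_def lower_def
    by (auto intro!: bounded_linear_imp_differentiable bounded_linear_vec_nth)
  have ent: "(\<lambda>U. P (upper U) $ i $ j) differentiable at ?U" for i j
    unfolding P chaos_mat_def sum_component vector_scaleR_component real_scaleR_def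
    by (intro differentiable_sum ballI differentiable_mult up differentiable_const finite_class.finite_UNIV)
  have N_diff: "?N differentiable at ?U"
    and ev: "\<forall>\<^sub>F U in nhds ?U. invertible (P (upper U))"
    using differentiable_matrix_inv_mult[OF ent lo] hi by simp_all
  then obtain N' where N': "(?N has_derivative N') (at ?U)" by (auto simp: differentiable_def)
  have N0: "?N ?U = u" using hi by (simp add: matrix_inv_mult_vec)
  have "((\<lambda>U. P (upper U) *v ?N U) has_derivative (\<lambda>V. P h *v N' V + P (upper V) *v u)) (at ?U)"
    by (rule derivative_eq_intros N' refl | simp add: hi matrix_inv_mult_vec)+
  moreover have "((\<lambda>U. P (upper U) *v ?N U) has_derivative lower) (at ?U)"
  proof (rule has_derivative_transform_eventually)
    show "(lower has_derivative lower) (at ?U)"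
      by (rule bounded_linear_imp_has_derivative[OF bounded_linear_lower])
    show "\<forall>\<^sub>F U in at ?U. lower U = P (upper U) *v ?N U"
      using ev by (auto simp: eventually_at_filter matrix_inv_mult_vec elim: eventually_mono)
    show "lower ?U = P (upper ?U) *v ?N ?U" using hi by (simp add: matrix_inv_mult_vec)
  qed simp
  ultimately have "(\<lambda>V. P h *v N' V + P (upper V) *v u) = lower" by (rule has_derivative_unique)
  then have PN: "P h *v N' V = lower V - P (upper V) *v u" for V
    unfolding eq_diff_eq by (rule fun_cong)
  have N'_eq: "N' V = matrix_inv (P h) *v (lower V - P u *v upper V)" for V
  proof -
    have "N' V = matrix_inv (P h) *v (P h *v N' V)" by (simp add: matrix_inv_mult_vec hi)
    also have "P h *v N' V = lower V - P u *v upper V"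
      unfolding PN unfolding P by (simp only: chaos_mat_swap[of \<rho> \<phi> u "upper V"])
    finally show ?thesis .
  qed
  have bl: "bounded_linear (\<lambda>b. stack 0 b :: real^('k+'k))" "bounded_linear (\<lambda>a. stack a 0 :: real^('k+'k))"
    by (auto simp: linear_conv_bounded_linear[symmetric] stack_def vec_eq_iff intro!: linearI split: sum.splits)
  have fl: "sgswe_flux P g U = stack (lower U) 0
      + stack 0 (P (lower U) *v ?N U + (g / 2) *\<^sub>R (P (upper U) *v upper U))" for U
    by (simp add: sgswe_flux_def Let_def stack_linear)
  have "((\<lambda>U. P (lower U) *v ?N U + (g / 2) *\<^sub>R (P (upper U) *v upper U)) has_derivative
     (\<lambda>V. (P (lower ?U) *v N' V + P (lower V) *v ?N ?U)
        + (g / 2) *\<^sub>R (P (upper ?U) *v upper V + P (upper V) *v upper ?U))) (at ?U)"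
    by (rule derivative_eq_intros N' refl)+
  also have "(\<lambda>V. (P (lower ?U) *v N' V + P (lower V) *v ?N ?U)
        + (g / 2) *\<^sub>R (P (upper ?U) *v upper V + P (upper V) *v upper ?U))
     = (\<lambda>V. P u *v lower V + P (P h *v u) *v N' V + g *\<^sub>R (P h *v upper V))"
  proof
    fix V
    have 1: "P (lower V) *v u = P u *v lower V" and 2: "P (upper V) *v h = P h *v upper V"
      unfolding P by (rule chaos_mat_swap)+
    show "(P (lower ?U) *v N' V + P (lower V) *v ?N ?U)
        + (g / 2) *\<^sub>R (P (upper ?U) *v upper V + P (upper V) *v upper ?U)
      = P u *v lower V + P (P h *v u) *v N' V + g *\<^sub>R (P h *v upper V)"
      unfolding N0 unfolding stack_upper_lower 1 2 by (simp flip: scaleR_2)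
  qed
  finally have lo_deriv: "((\<lambda>U. P (lower U) *v ?N U + (g / 2) *\<^sub>R (P (upper U) *v upper U)) has_derivative
     (\<lambda>V. P u *v lower V + P (P h *v u) *v N' V + g *\<^sub>R (P h *v upper V))) (at ?U)" .
  have "(sgswe_flux P g has_derivative (\<lambda>V. stack (lower V) 0
      + stack 0 (P u *v lower V + P (P h *v u) *v N' V + g *\<^sub>R (P h *v upper V)))) (at ?U)"
    unfolding fl
    by (intro has_derivative_add bounded_linear.has_derivative[OF bl(1) lo_deriv]
        bounded_linear_imp_has_derivative bounded_linear_compose[OF bl(2) bounded_linear_lower])
  then show ?thesis unfolding N'_eq stack_linear by simp
qed

lemma roe_R_stack:
  "roe_R P g u G *v stack a b
    = (1 / sqrt (2 * g)) *\<^sub>R stack (a + b) (P u *v (a + b) + G *v (a - b))"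
  by (simp add: roe_R_def block_mat_stack scaleR_matrix_vector_assoc[symmetric] algebra_simps
      matrix_vector_mult_add_rdistrib matrix_vector_mult_diff_rdistrib matrix_vector_right_distrib
      matrix_vector_mult_diff_distrib)

lemma invertible_roe_R:
  assumes "g > 0" "invertible G"
  shows "invertible (roe_R P g u G)"
proof -
  have "V = 0" if V: "roe_R P g u G *v V = 0" for V
  proof -
    obtain a b where ab: "V = stack a b" by (metis stack_upper_lower(3))
    have "stack (a + b) (P u *v (a + b) + G *v (a - b)) = 0"
      using V assms(1) unfolding ab roe_R_stack by simp
    then have "upper (stack (a + b) (P u *v (a + b) + G *v (a - b))) = upper 0"
      and "lower (stack (a + b) (P u *v (a + b) + G *v (a - b))) = lower 0" by simp_all
    then have s: "a + b = 0" and d: "P u *v (a + b) + G *v (a - b) = 0"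
      unfolding stack_upper_lower by (simp_all add: upper_def lower_def vec_eq_iff)
    have "G *v (a - b) = 0" using d unfolding s by simp
    then have "a - b = 0" using matrix_inv_mult_vec(2)[OF assms(2), of "a - b"] by simp
    then have "2 *\<^sub>R b = 0" "a = b" using s by (simp_all add: scaleR_2)
    then have "a = 0" "b = 0" by simp_all
    then show "V = 0" by (simp add: ab stack_def vec_eq_iff split: sum.splits)
  qed
  then show ?thesis using invertible_left_inverse matrix_left_invertible_ker by blast
qed

lemma sgswe_flux_jacobian:
  assumes P: "P = chaos_mat \<rho> \<phi>" and g: "g > 0" and h: "pos_def (P h)"
    and G: "pos_def G" and GG: "G ** G = g *\<^sub>R P h"
  shows "(sgswe_flux P g has_derivative
     (\<lambda>V. (roe_R P g u G ** roe_D P g h u G ** matrix_inv (roe_R P g u G)) *v V))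
     (at (stack h (P h *v u)))"
proof -
  let ?R = "roe_R P g u G" and ?D = "roe_D P g h u G" and ?q = "P h *v u"
  let ?J = "\<lambda>V. stack (lower V) (P u *v lower V
    + P ?q *v (matrix_inv (P h) *v (lower V - P u *v upper V)) + g *\<^sub>R (P h *v upper V))"
  have Gi: "invertible G" and hi: "invertible (P h)" using G h by (auto intro: pos_def_invertible)
  have Ri: "invertible ?R" using g Gi by (rule invertible_roe_R)
  have Ph: "g *\<^sub>R (P h *v x) = G *v (G *v x)" for x
    by (simp add: matrix_vector_mul_assoc GG scaleR_matrix_vector_assoc)
  have Pinv: "matrix_inv (P h) *v (G *v x) = g *\<^sub>R (matrix_inv G *v x)" for x
  proof -
    have "G *v x = G *v (G *v (matrix_inv G *v x))" by (simp add: matrix_inv_mult_vec Gi)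
    also have "\<dots> = P h *v (g *\<^sub>R (matrix_inv G *v x))"
      unfolding Ph[symmetric] by (simp add: matrix_vector_mult_scaleR)
    finally show ?thesis by (simp add: matrix_inv_mult_vec hi)
  qed
  have RD: "?J (?R *v W) = ?R *v (?D *v W)" for W
  proof -
    obtain a b where W: "W = stack a b" by (metis stack_upper_lower(3))
    define A where "A = g *\<^sub>R (matrix_inv G ** P ?q ** matrix_inv G)"
    have GA: "G *v (A *v x) = g *\<^sub>R (P ?q *v (matrix_inv G *v x))" for x
      by (simp add: A_def scaleR_matrix_vector_assoc[symmetric] matrix_vector_mult_scaleR
          matrix_vector_mul_assoc[symmetric] matrix_inv_mult_vec Gi)
    define a' where "a' = (1/2) *\<^sub>R (2 *\<^sub>R (G *v a) + P u *v (a + b) + A *v (a - b))"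
    define b' where "b' = (1/2) *\<^sub>R (P u *v (a + b) - A *v (a - b) - 2 *\<^sub>R (G *v b))"
    have D: "?D *v W = stack a' b'"
      unfolding W roe_D_def Let_def A_def[symmetric] a'_def b'_def
      by (simp add: block_mat_stack scaleR_matrix_vector_assoc[symmetric] stack_linear algebra_simps
          matrix_vector_mult_add_rdistrib matrix_vector_mult_diff_rdistrib matrix_vector_right_distrib
          matrix_vector_mult_diff_distrib)
    have s: "a' + b' = P u *v (a + b) + G *v (a - b)"
      and d: "a' - b' = G *v (a + b) + A *v (a - b)"
      unfolding a'_def b'_def
      by (simp_all add: vec_eq_iff matrix_vector_right_distrib matrix_vector_mult_diff_distrib field_simps)
    have J_scale: "?J (c *\<^sub>R V) = c *\<^sub>R ?J V" for c V
    proof -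
      have 1: "lower (c *\<^sub>R V) - P u *v upper (c *\<^sub>R V) = c *\<^sub>R (lower V - P u *v upper V)"
        by (simp add: upper_scaleR lower_scaleR matrix_vector_mult_scaleR scaleR_diff_right)
      show ?thesis
        unfolding 1 unfolding upper_scaleR lower_scaleR matrix_vector_mult_scaleR stack_linear
        by (simp add: scaleR_add_right mult.commute)
    qed
    show ?thesis
      unfolding D roe_R_stack s d unfolding W roe_R_stack J_scale stack_upper_lower
      by (simp only: Pinv matrix_vector_right_distrib[of G] GA Ph matrix_vector_mult_scaleR
          add_diff_cancel_left') (simp only: add_ac)
  qed
  have "?J V = (?R ** ?D ** matrix_inv ?R) *v V" for V
    using RD[of "matrix_inv ?R *v V"]
    by (simp add: matrix_inv_mult_vec Ri matrix_vector_mul_assoc[symmetric])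
  then show ?thesis
    using sgswe_flux_has_derivative[OF P h, of g u] by simp
qed

lemma roe_eigendecompositionI:
  assumes P: "P = chaos_mat \<rho> \<phi>" and g: "g > 0" and h: "pos_def (P h)"
    and G: "pos_def G" "G ** G = g *\<^sub>R P h"
    and L: "orthogonal_matrix L" "diagonal_mat \<Lambda>" "roe_D P g h u G = L ** \<Lambda> ** transpose L"
  shows "roe_eigendecomposition P g h u (roe_R P g u G ** L) \<Lambda>"
proof -
  let ?R = "roe_R P g u G"
  have Ri: "invertible ?R" using g pos_def_invertible[OF G(1)] by (rule invertible_roe_R)
  have Li: "invertible L" using L(1) by (auto simp: invertible_def orthogonal_matrix_def)
  have Ti: "invertible (?R ** L)" using Ri Li by (rule invertible_mult)
  have "matrix_inv (?R ** L) *v V = transpose L *v (matrix_inv ?R *v V)" for V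
  proof -
    have "(?R ** L) *v (transpose L *v (matrix_inv ?R *v V)) = ?R *v ((L ** transpose L) *v (matrix_inv ?R *v V))"
      by (simp only: matrix_vector_mul_assoc matrix_mul_assoc)
    also have "\<dots> = V" using L(1) by (simp add: orthogonal_matrix_def matrix_inv_mult_vec Ri)
    finally show ?thesis using matrix_inv_mult_vec(2)[OF Ti] by metis
  qed
  then have "((?R ** L) ** \<Lambda> ** matrix_inv (?R ** L)) *v V = (?R ** roe_D P g h u G ** matrix_inv ?R) *v V" for V
    unfolding L(3) by (simp add: matrix_vector_mul_assoc[symmetric])
  then have "(?R ** L) ** \<Lambda> ** matrix_inv (?R ** L) = ?R ** roe_D P g h u G ** matrix_inv ?R"
    by (simp add: matrix_eq)
  then show ?thesis
    using sgswe_flux_jacobian[OF P g h G, of u] G L Ti unfolding roe_eigendecomposition_def by auto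
qed

subsection \<open>Numerical fluxes and source\<close>

definition ec_flux ::
  "(real^'k \<Rightarrow> real^'k^'k) \<Rightarrow> real \<Rightarrow> 'k::finite cell \<Rightarrow> 'k cell \<Rightarrow> real^('k + 'k)" where
  "ec_flux P g a b =
     stack (P (avg_h a b) *v avg_u P a b)
       ((g / 2) *\<^sub>R avg (P (cell_h a) *v cell_h a) (P (cell_h b) *v cell_h b)
         + P (avg_u P a b) *v (P (avg_h a b) *v avg_u P a b))"

text \<open>\<open>T a b\<close> and \<open>\<Lambda> a b\<close> are the matrices chosen at the interface between the left cell \<open>a\<close>
  and the right cell \<open>b\<close>.\<close>

definition es1_matrix ::
  "('k::finite cell \<Rightarrow> 'k cell \<Rightarrow> real^('k + 'k)^('k + 'k))
    \<Rightarrow> ('k cell \<Rightarrow> 'k cell \<Rightarrow> real^('k + 'k)^('k + 'k))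
    \<Rightarrow> 'k cell \<Rightarrow> 'k cell \<Rightarrow> real^('k + 'k)^('k + 'k)" where
  "es1_matrix T \<Lambda> a b = T a b ** abs_mat (\<Lambda> a b) ** transpose (T a b)"

definition es1_flux ::
  "(real^'k \<Rightarrow> real^'k^'k) \<Rightarrow> real
    \<Rightarrow> ('k::finite cell \<Rightarrow> 'k cell \<Rightarrow> real^('k + 'k)^('k + 'k))
    \<Rightarrow> ('k cell \<Rightarrow> 'k cell \<Rightarrow> real^('k + 'k)^('k + 'k))
    \<Rightarrow> 'k cell \<Rightarrow> 'k cell \<Rightarrow> real^('k + 'k)" where
  "es1_flux P g T \<Lambda> a b =
     ec_flux P g a b
       - (1 / 2) *\<^sub>R (es1_matrix T \<Lambda> a b *v jump (entropy_var P g a) (entropy_var P g b))"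

definition num_source ::
  "(real^'k \<Rightarrow> real^'k^'k) \<Rightarrow> real \<Rightarrow> real \<Rightarrow> 'k::finite cell \<Rightarrow> 'k cell \<Rightarrow> 'k cell \<Rightarrow> real^('k + 'k)" where
  "num_source P g \<Delta>x a b c =
     stack 0 (- ((g / (2 * \<Delta>x)) *\<^sub>R
       (P (avg_h b c) *v jump (cell_B b) (cell_B c) + P (avg_h a b) *v jump (cell_B a) (cell_B b))))"

subsection \<open>Semidiscrete finite volume schemes and their properties\<close>

text \<open>A scheme is given by a two-point numerical flux \<open>F\<close>, whose value at the interface
  $x_{i+1/2}$ is \<open>F (c i) (c (i + 1))\<close>, and a three-point source \<open>S\<close> depending on the mesh width.\<close>

type_synonym 'k num_flux = "'k cell \<Rightarrow> 'k cell \<Rightarrow> real^('k + 'k)"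
type_synonym 'k num_src = "real \<Rightarrow> 'k cell \<Rightarrow> 'k cell \<Rightarrow> 'k cell \<Rightarrow> real^('k + 'k)"

definition fv_rhs ::
  "'k::finite num_flux \<Rightarrow> 'k num_src \<Rightarrow> real \<Rightarrow> (int \<Rightarrow> 'k cell) \<Rightarrow> int \<Rightarrow> real^('k + 'k)" where
  "fv_rhs F S \<Delta>x c i =
     - ((1 / \<Delta>x) *\<^sub>R (F (c i) (c (i + 1)) - F (c (i - 1)) (c i)))
     + S \<Delta>x (c (i - 1)) (c i) (c (i + 1))"

text \<open>The mesh consists of the cells with index in \<open>J\<close>; \<open>J = UNIV\<close> is the infinite mesh, which
  includes periodic ones. The scheme is imposed on the cells both of whose neighbors are in the mesh.\<close>

definition interior_cells :: "int set \<Rightarrow> int set" where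
  "interior_cells J = {i \<in> J. i - 1 \<in> J \<and> i + 1 \<in> J}"

definition fv_solution ::
  "(real^'k \<Rightarrow> real^'k^'k) \<Rightarrow> 'k::finite num_flux \<Rightarrow> 'k num_src \<Rightarrow> real \<Rightarrow> int set \<Rightarrow> real set
    \<Rightarrow> (int \<Rightarrow> real^'k) \<Rightarrow> (int \<Rightarrow> real \<Rightarrow> real^('k + 'k)) \<Rightarrow> bool" where
  "fv_solution P F S \<Delta>x J I B U \<longleftrightarrow>
     (\<forall>i\<in>J. \<forall>t\<in>I. pos_def (P (upper (U i t)))) \<and>
     (\<forall>i\<in>interior_cells J. \<forall>t\<in>I.
        (U i has_vector_derivative fv_rhs F S \<Delta>x (\<lambda>j. (U j t, B j)) i) (at t within I))"

text \<open>The numerical entropy flux \<open>H\<close> is one function for all meshes and all solutions.\<close>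

definition energy_stable ::
  "(real^'k \<Rightarrow> real^'k^'k) \<Rightarrow> real \<Rightarrow> 'k::finite num_flux \<Rightarrow> 'k num_src \<Rightarrow> bool" where
  "energy_stable P g F S \<longleftrightarrow>
     (\<exists>H :: 'k cell \<Rightarrow> 'k cell \<Rightarrow> real.
        \<forall>\<Delta>x>0. \<forall>J I B U. is_interval I \<and> fv_solution P F S \<Delta>x J I B U \<longrightarrow>
          (\<forall>i\<in>interior_cells J. \<forall>t\<in>I. \<exists>E'.
             ((\<lambda>s. cell_energy P g (U i s, B i)) has_real_derivative E') (at t within I) \<and>
             E' \<le> - (1 / \<Delta>x) *
                    (H (U i t, B i) (U (i + 1) t, B (i + 1)) - H (U (i - 1) t, B (i - 1)) (U i t, B i))))"

text \<open>The time derivatives of $h_i$ and $q_i$ are the two halves of the right-hand side.\<close>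

definition well_balanced ::
  "(real^'k \<Rightarrow> real^'k^'k) \<Rightarrow> 'k::finite num_flux \<Rightarrow> 'k num_src \<Rightarrow> bool" where
  "well_balanced P F S \<longleftrightarrow>
     (\<forall>\<Delta>x>0. \<forall>J c.
        (\<forall>i\<in>J. pos_def (P (cell_h (c i)))) \<and>
        (\<forall>i\<in>J. cell_u P (c i) = 0) \<and>
        (\<exists>w. \<forall>i\<in>J. cell_h (c i) + cell_B (c i) = w) \<longrightarrow>
        (\<forall>i\<in>interior_cells J. upper (fv_rhs F S \<Delta>x c i) = 0 \<and> lower (fv_rhs F S \<Delta>x c i) = 0))"

definition smooth_fun_on :: "real set \<Rightarrow> (real \<Rightarrow> 'a::real_normed_vector) \<Rightarrow> bool" where
  "smooth_fun_on X f \<longleftrightarrow>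
     (\<exists>D. (\<forall>x\<in>X. D (0::nat) x = f x) \<and>
          (\<forall>n. \<forall>x\<in>X. (D n has_vector_derivative D (Suc n) x) (at x)))"

definition cell_average :: "(real \<Rightarrow> real^'n) \<Rightarrow> real \<Rightarrow> real \<Rightarrow> real^'n" where
  "cell_average f \<Delta>x x = (1 / \<Delta>x) *\<^sub>R integral {x - \<Delta>x / 2 .. x + \<Delta>x / 2} f"

text \<open>\<open>X\<close> is the open spatial domain on which \<open>U\<close> (at a fixed time) and \<open>B\<close> are smooth; the mesh
  has cell centers \<open>x0 + i * \<Delta>x\<close>. The constant \<open>C\<close> and the threshold on \<open>\<Delta>x\<close> may depend on the
  compact set \<open>K\<close>, and are uniform over the positions of the mesh relative to \<open>K\<close>.\<close>

definition first_order ::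
  "(real^'k \<Rightarrow> real^'k^'k) \<Rightarrow> real \<Rightarrow> 'k::finite num_flux \<Rightarrow> 'k num_src \<Rightarrow> bool" where
  "first_order P g F S \<longleftrightarrow>
     (\<forall>X (U :: real \<Rightarrow> real^('k + 'k)) (B :: real \<Rightarrow> real^'k).
        open X \<and> smooth_fun_on X U \<and> smooth_fun_on X B \<and> (\<forall>x\<in>X. pos_def (P (upper (U x)))) \<longrightarrow>
        (\<forall>K. compact K \<and> K \<subseteq> X \<longrightarrow>
          (\<exists>C. \<forall>\<^sub>F \<Delta>x in at_right 0. \<forall>(x0::real) (i::int).
             let x = (\<lambda>s. x0 + s * \<Delta>x);
                 c = (\<lambda>j. (cell_average U \<Delta>x (x (of_int j)), cell_average B \<Delta>x (x (of_int j))));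
                 xi = x (of_int i); xh = x (of_int i + 1 / 2)
             in (xh \<in> K \<longrightarrow> norm (F (c i) (c (i + 1)) - sgswe_flux P g (U xh)) \<le> C * \<Delta>x) \<and>
                (xi \<in> K \<longrightarrow>
                   norm (S \<Delta>x (c (i - 1)) (c i) (c (i + 1))
                     - sgswe_source P g (U xi) (vector_derivative B (at xi))) \<le> C * \<Delta>x))))"

end

theory Submission
  imports Defs
begin

text \<open>
  Energy stability: the jump of the entropy variable tested against the energy conservative flux is
  the jump of a potential plus a bottom contribution which telescopes together with the source term,
  because \<open>(a, b, c) \<mapsto> a \<bullet> (P b *v c)\<close> is a symmetric trilinear form. The diffusion only adds the
  quadratic form of \<open>T ** \<bar>\<Lambda>\<bar> ** transpose T\<close>, which is nonnegative since \<open>\<Lambda>\<close> is diagonal.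
  Well-balancing is the same algebra, as the entropy variable of a lake at rest is constant.

  Accuracy: \<open>T\<close> and \<open>\<Lambda>\<close> need not depend continuously on the states, but they only enter through
  $T|\Lambda|T^T = RL|\Lambda|L^TR^T$ with \<open>L\<close> orthogonal and $\Lambda = L^TDL$, which is bounded in terms of \<open>R\<close> and
  \<open>D\<close>. These are bounded as long as \<open>P h\<close> is bounded and uniformly coercive; hence the diffusion is as
  small as the jump of the entropy variable, and everything else is multilinear in \<open>h\<close> and \<open>u\<close>.
\<close>

subsection \<open>Well-balancing and energy stability\<close>

lemma stack_inner: "stack a b \<bullet> stack c d = a \<bullet> c + b \<bullet> d"
  by (simp add: inner_vec_def stack_def UNIV_Plus_UNIV[symmetric] sum.Plus del: UNIV_Plus_UNIV)

lemma stack_diff: "stack a b - stack c d = stack (a - c) (b - d)"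
  by (auto simp: stack_def vec_eq_iff split: sum.splits)

lemma stack_uminus: "- stack a b = stack (- a) (- b)"
  by (auto simp: stack_def vec_eq_iff split: sum.splits)

lemma stack_zero: "stack 0 0 = 0"
  by (auto simp: stack_def vec_eq_iff split: sum.splits)

lemma inner_matrix_vector_transpose:
  fixes A :: "real^'n^'m"
  shows "x \<bullet> (A *v y) = (transpose A *v x) \<bullet> y"
  by (simp add: transpose_matrix_vector dot_lmul_matrix)

lemma chaos_mat_transpose: "transpose (chaos_mat \<rho> \<phi> z) = chaos_mat \<rho> \<phi> z"
  by (simp add: chaos_mat_def triple_mat_def transpose_def vec_eq_iff mult.commute)

text \<open>The algebraic properties of \<open>chaos_mat\<close> used below. Together they say that
  \<open>x \<bullet> (P a *v y)\<close> is trilinear and invariant under all permutations of its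
  three arguments, like the integral of a product of three functions.\<close>

locale sg_matrix =
  fixes P :: "real^'k::finite \<Rightarrow> real^'k^'k"
  assumes bilinear: "bounded_bilinear (\<lambda>a b. P a *v b)"
    and swap: "P a *v b = P b *v a"
    and symmetric: "transpose (P a) = P a"
begin

sublocale prod: bounded_bilinear "\<lambda>a b. P a *v b"
  by (rule bilinear)

lemma inner_left: "x \<bullet> (P a *v y) = (P a *v x) \<bullet> y"
  by (simp add: inner_matrix_vector_transpose symmetric)

text \<open>The analogue of b^2 - a^2 = (b + a)(b - a): by \<open>swap\<close> the mixed products
  \<open>P a *v b\<close> and \<open>P b *v a\<close> cancel.\<close>

lemma jump_square:
  "P b *v b - P a *v a = 2 *\<^sub>R (P (avg a b) *v (b - a))"
  by (simp add: avg_def prod.add_left prod.diff_right prod.scaleR_left swap[of b a] algebra_simps)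

text \<open>The entropy flux potential: entropy variable tested against the physical flux, minus the
  entropy flux. The bottom contributions cancel in this difference.\<close>

definition energy_potential :: "real \<Rightarrow> 'k cell \<Rightarrow> real" where
  "energy_potential g a = g / 2 * (cell_u P a \<bullet> (P (cell_h a) *v cell_h a))"

text \<open>Tadmor's discrete condition for energy conservation, up to a bottom term that the source
  absorbs later. The kinetic terms cancel by symmetry of the trilinear form, and the gravity terms
  combine to the jump of the potential.\<close>

lemma entropy_jump_ec_flux:
  "jump (entropy_var P g a) (entropy_var P g b) \<bullet> ec_flux P g a b
    = energy_potential g b - energy_potential g a
      + g * (jump (cell_B a) (cell_B b) \<bullet> (P (avg_h a b) *v avg_u P a b))"
proof -
  define ha hb ua ub where "ha = cell_h a" "hb = cell_h b" "ua = cell_u P a" "ub = cell_u P b"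
  note defs = this
  define ha2 hb2 where "ha2 = P ha *v ha" "hb2 = P hb *v hb"
  note defs2 = this
  let ?h = "avg ha hb" and ?u = "avg ua ub"
  let ?m = "P ?h *v ?u"
  have V: "jump (entropy_var P g a) (entropy_var P g b)
      = stack (g *\<^sub>R (hb - ha) + g *\<^sub>R jump (cell_B a) (cell_B b) - P ?u *v (ub - ua)) (ub - ua)"
  proof -
    have e: "(1/2) *\<^sub>R (P ub *v ub) = (1/2) *\<^sub>R (P ua *v ua) + P ?u *v (ub - ua)"
      using arg_cong[OF jump_square[of ub ua], of "scaleR (1/2)"] by (simp add: scaleR_diff_right diff_eq_eq add.commute)
    show ?thesis
      unfolding entropy_var_def jump_def stack_diff defs[symmetric] e
      by (simp add: algebra_simps)
  qed
  have 1: "(hb - ha) \<bullet> ?m = (1/2) * ((hb2 - ha2) \<bullet> ?u)"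
    unfolding inner_left[of "hb - ha"] defs2 jump_square[of hb ha] by simp
  \<comment> \<open>The left side comes from the momentum flux, the right side from the quadratic
    velocity term of the entropy variable; they enter with opposite signs.\<close>
  have 2: "(ub - ua) \<bullet> (P ?u *v ?m) = (P ?u *v (ub - ua)) \<bullet> ?m"
    by (rule inner_left)
  \<comment> \<open>Product rule for jumps: jump times average plus average times jump.\<close>
  have 3: "ub \<bullet> hb2 - ua \<bullet> ha2 = (hb2 - ha2) \<bullet> ?u + (ub - ua) \<bullet> avg ha2 hb2"
    by (simp add: avg_def inner_diff_left inner_diff_right inner_add_left inner_add_right
        inner_commute field_simps)
  have "jump (entropy_var P g a) (entropy_var P g b) \<bullet> ec_flux P g a b
     = g * ((hb - ha) \<bullet> ?m) + g * (jump (cell_B a) (cell_B b) \<bullet> ?m)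
       + g / 2 * ((ub - ua) \<bullet> avg ha2 hb2)"
    unfolding V ec_flux_def avg_h_def avg_u_def defs[symmetric] defs2[symmetric] stack_inner
    by (simp add: inner_add_left inner_diff_left inner_add_right 2[unfolded inner_diff_left] algebra_simps)
  also have "\<dots> = g / 2 * (ub \<bullet> hb2 - ua \<bullet> ha2) + g * (jump (cell_B a) (cell_B b) \<bullet> ?m)"
    unfolding 1 3 by (simp add: algebra_simps)
  finally show ?thesis
    unfolding energy_potential_def avg_h_def avg_u_def defs[symmetric] defs2[symmetric]
    by (simp add: algebra_simps)
qed

text \<open>For a lake at rest both the flux difference and the source reduce to differences of
  \<open>P h *v h\<close> between cells, with matching coefficients.\<close>

lemma well_balanced_es1:
  "well_balanced P (es1_flux P g T \<Lambda>) (num_source P g)"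
  unfolding well_balanced_def
proof (intro allI impI ballI, elim conjE exE)
  fix \<Delta>x :: real and J c i w
  assume dx: "\<Delta>x > 0" and u: "\<forall>i\<in>J. cell_u P (c i) = 0"
    and w: "\<forall>i\<in>J. cell_h (c i) + cell_B (c i) = w" and i: "i \<in> interior_cells J"
  have J: "i \<in> J" "i - 1 \<in> J" "i + 1 \<in> J" using i by (auto simp: interior_cells_def)
  let ?H = "\<lambda>i. P (cell_h (c i)) *v cell_h (c i)"
  \<comment> \<open>At rest every cell has the same entropy variable, so the diffusion vanishes
    whatever \<open>T\<close> and \<open>\<Lambda>\<close> are, and only the averaged pressure
    survives.\<close>
  have flux: "es1_flux P g T \<Lambda> (c i) (c j) = stack 0 ((g / 4) *\<^sub>R (?H i + ?H j))"
    if "i \<in> J" "j \<in> J" for i j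
    using that u w unfolding es1_flux_def ec_flux_def entropy_var_def jump_def
    by (simp add: avg_u_def avg_def prod.zero_left prod.zero_right)
  \<comment> \<open>Since \<open>h + B\<close> is constant, the bottom jump is minus the height
    jump, and \<open>jump_square\<close> turns the source into pressure differences.\<close>
  have B: "P (avg_h (c i) (c j)) *v jump (cell_B (c i)) (cell_B (c j)) = (1/2) *\<^sub>R (?H i - ?H j)"
    if "i \<in> J" "j \<in> J" for i j
  proof -
    have "cell_B (c i) = w - cell_h (c i)" "cell_B (c j) = w - cell_h (c j)"
      using w that by (auto simp: algebra_simps)
    then have "jump (cell_B (c i)) (cell_B (c j)) = cell_h (c i) - cell_h (c j)"
      by (simp add: jump_def)
    then show ?thesis
      using jump_square[of "cell_h (c i)" "cell_h (c j)"]
      by (simp add: avg_h_def avg_def add.commute)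
  qed
  have "fv_rhs (es1_flux P g T \<Lambda>) (num_source P g) \<Delta>x c i = 0"
    unfolding fv_rhs_def num_source_def flux[OF J(1) J(3)] flux[OF J(2) J(1)] B[OF J(1) J(3)] B[OF J(2) J(1)]
      stack_diff stack_linear stack_uminus
    by (simp add: stack_zero[symmetric] algebra_simps)
  then show "upper (fv_rhs (es1_flux P g T \<Lambda>) (num_source P g) \<Delta>x c i) = 0 \<and>
      lower (fv_rhs (es1_flux P g T \<Lambda>) (num_source P g) \<Delta>x c i) = 0"
    by (simp add: upper_def lower_def vec_eq_iff)
qed

end

section \<open>Nonnegativity of the diffusion\<close>

lemma diagonal_mat_mult:
  assumes "diagonal_mat D"
  shows "(D *v x) $ i = D $ i $ i * x $ i"
proof -
  have "(D *v x) $ i = (\<Sum>j\<in>UNIV. if j = i then D $ i $ i * x $ i else 0)"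
    unfolding matrix_vector_mult_def vec_lambda_beta
    using assms by (intro sum.cong) (auto simp: diagonal_mat_def)
  then show ?thesis by simp
qed

lemma diagonal_mat_abs_mat: "diagonal_mat D \<Longrightarrow> diagonal_mat (abs_mat D)"
  by (simp add: diagonal_mat_def abs_mat_def)

lemma inner_abs_mat_nonneg:
  assumes "diagonal_mat D"
  shows "x \<bullet> (abs_mat D *v x) \<ge> 0"
proof -
  have "abs_mat D $ i $ i \<ge> 0" for i by (simp add: abs_mat_def)
  then show ?thesis
    unfolding inner_vec_def diagonal_mat_mult[OF diagonal_mat_abs_mat[OF assms]]
    by (intro sum_nonneg) (simp add: mult.left_commute[of "x $ i" for i])
qed

text \<open>Congruence moves the quadratic form to \<open>transpose (T a b) *v x\<close>, on which a
  nonnegative diagonal matrix acts.\<close>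

lemma inner_es1_matrix_nonneg:
  assumes "diagonal_mat (\<Lambda> a b)"
  shows "x \<bullet> (es1_matrix T \<Lambda> a b *v x) \<ge> 0"
proof -
  have "x \<bullet> (es1_matrix T \<Lambda> a b *v x)
      = (transpose (T a b) *v x) \<bullet> (abs_mat (\<Lambda> a b) *v (transpose (T a b) *v x))"
    by (simp only: es1_matrix_def matrix_vector_mul_assoc[symmetric] inner_matrix_vector_transpose[of x "T a b"])
  then show ?thesis using inner_abs_mat_nonneg[OF assms] by simp
qed

section \<open>The energy balance of one cell\<close>

context sg_matrix
begin

text \<open>Confirms that \<open>entropy_var\<close> is the gradient of the energy at fixed bottom.
  The derivative \<open>N'\<close> of the velocity is never computed explicitly: the energy only
  involves it paired with \<open>q = P h *v u\<close>, and differentiating this relation determines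
  the pairing.\<close>

lemma has_derivative_cell_energy:
  assumes inv: "invertible (P (upper V0))"
  shows "((\<lambda>V. cell_energy P g (V, B)) has_derivative (\<lambda>V. entropy_var P g (V0, B) \<bullet> V)) (at V0)"
proof -
  note [derivative_intros] = prod.FDERIV bounded_linear.has_derivative[OF bounded_linear_upper]
    bounded_linear.has_derivative[OF bounded_linear_lower]
  let ?N = "\<lambda>V. matrix_inv (P (upper V)) *v lower V"
  let ?u = "?N V0"
  have lo: "(\<lambda>V. lower V $ i) differentiable at V0" for i
    by (intro bounded_linear_imp_differentiable bounded_linear_compose[OF bounded_linear_vec_nth bounded_linear_lower])
  \<comment> \<open>The locale speaks only of products \<open>P a *v b\<close>; reading entries off
    the columns makes them linear in \<open>a\<close>.\<close>
  have "P a $ i $ j = (P a *v axis j 1) $ i" for a i j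
    by (simp add: matrix_vector_mul_component column_def inner_axis)
  then have ent: "(\<lambda>V. P (upper V) $ i $ j) differentiable at V0" for i j
    by (auto intro!: bounded_linear_imp_differentiable
        bounded_linear_compose[OF bounded_linear_vec_nth]
        bounded_linear_compose[OF prod.bounded_linear_left bounded_linear_upper])
  have N_diff: "?N differentiable at V0"
    and ev: "\<forall>\<^sub>F V in nhds V0. invertible (P (upper V))"
    using differentiable_matrix_inv_mult[OF ent lo inv] by simp_all
  then obtain N' where N': "(?N has_derivative N') (at V0)" by (auto simp: differentiable_def)
  have "((\<lambda>V. P (upper V) *v ?N V) has_derivative (\<lambda>V. P (upper V0) *v N' V + P (upper V) *v ?u)) (at V0)"
    by (rule derivative_eq_intros N' refl)+
  \<comment> \<open>Near \<open>V0\<close> the differentiated product is just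
    \<open>lower V\<close>, so uniqueness of the derivative yields a linear equation for
    \<open>N'\<close>.\<close>
  moreover have "((\<lambda>V. P (upper V) *v ?N V) has_derivative lower) (at V0)"
  proof (rule has_derivative_transform_eventually)
    show "(lower has_derivative lower) (at V0)"
      by (rule bounded_linear_imp_has_derivative[OF bounded_linear_lower])
    show "\<forall>\<^sub>F V in at V0. lower V = P (upper V) *v ?N V"
      using ev by (auto simp: eventually_at_filter matrix_inv_mult_vec elim: eventually_mono)
    show "lower V0 = P (upper V0) *v ?N V0" using inv by (simp add: matrix_inv_mult_vec)
  qed simp
  ultimately have "(\<lambda>V. P (upper V0) *v N' V + P (upper V) *v ?u) = lower"
    by (rule has_derivative_unique)
  then have PN: "P (upper V0) *v N' V = lower V - P (upper V) *v ?u" for V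
    unfolding eq_diff_eq by (rule fun_cong)
  \<comment> \<open>Symmetry of \<open>P h\<close> moves it from \<open>u\<close> onto
    \<open>N' V\<close>, where the linear equation \<open>PN\<close> applies.\<close>
  have lowN: "lower V0 \<bullet> N' V = ?u \<bullet> lower V - upper V \<bullet> (P ?u *v ?u)" for V
  proof -
    have "lower V0 \<bullet> N' V = ?u \<bullet> (P (upper V0) *v N' V)"
      using inv by (simp add: inner_left matrix_inv_mult_vec)
    also have "\<dots> = ?u \<bullet> lower V - ?u \<bullet> (P ?u *v upper V)"
      by (simp add: PN inner_diff_right swap[of "upper V"])
    finally show ?thesis
      by (simp only: inner_left[of ?u ?u "upper V"] inner_commute[of "upper V"])
  qed
  have lin: "(upper has_derivative upper) (at V0)" "(lower has_derivative lower) (at V0)"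
    by (intro bounded_linear_imp_has_derivative bounded_linear_upper bounded_linear_lower)+
  have "((\<lambda>V. (1 / 2) * (lower V \<bullet> ?N V + g * (upper V \<bullet> upper V)) + g * (upper V \<bullet> B)) has_derivative
      (\<lambda>V. (1 / 2) * ((lower V0 \<bullet> N' V + lower V \<bullet> ?u) + g * (upper V0 \<bullet> upper V + upper V \<bullet> upper V0))
        + g * (upper V \<bullet> B))) (at V0)"
    by (intro has_derivative_add has_derivative_mult_right has_derivative_inner has_derivative_inner_left lin N')
  moreover have "(1 / 2) * ((lower V0 \<bullet> N' V + lower V \<bullet> ?u) + g * (upper V0 \<bullet> upper V + upper V \<bullet> upper V0))
        + g * (upper V \<bullet> B) = entropy_var P g (V0, B) \<bullet> V" for V
  proof -
    have "entropy_var P g (V0, B) \<bullet> V = entropy_var P g (V0, B) \<bullet> stack (upper V) (lower V)" by simp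
    also have "\<dots> = - (1/2) * ((P ?u *v ?u) \<bullet> upper V) + g * (upper V0 \<bullet> upper V) + g * (B \<bullet> upper V) + ?u \<bullet> lower V"
      unfolding entropy_var_def stack_inner
      by (simp add: cell_u_def cell_h_def cell_q_def cell_B_def inner_diff_left inner_add_left distrib_left)
    finally show ?thesis
      unfolding lowN inner_commute[of "lower V" ?u] inner_commute[of "upper V" B]
        inner_commute[of "upper V" "upper V0"] inner_commute[of "upper V" "P ?u *v ?u"]
      by (simp add: distrib_left diff_divide_distrib)
  qed
  ultimately have "((\<lambda>V. (1 / 2) * (lower V \<bullet> ?N V + g * (upper V \<bullet> upper V)) + g * (upper V \<bullet> B)) has_derivative
      (\<lambda>V. entropy_var P g (V0, B) \<bullet> V)) (at V0)" by simp
  then show ?thesis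
    by (simp add: cell_energy_def cell_u_def cell_h_def cell_q_def cell_B_def power2_norm_eq_inner)
qed

text \<open>Averaged entropy variable against the flux minus the averaged potential is Tadmor's
  entropy flux. The last term is needed because the source is tested against the velocity of one
  cell, whereas the jump identity contains the averaged velocity.\<close>

definition energy_flux ::
  "real \<Rightarrow> ('k cell \<Rightarrow> 'k cell \<Rightarrow> real^('k + 'k)^('k + 'k)) \<Rightarrow> ('k cell \<Rightarrow> 'k cell \<Rightarrow> real^('k + 'k)^('k + 'k))
    \<Rightarrow> 'k cell \<Rightarrow> 'k cell \<Rightarrow> real" where
  "energy_flux g T \<Lambda> a b =
     avg (entropy_var P g a) (entropy_var P g b) \<bullet> es1_flux P g T \<Lambda> a b
     - (energy_potential g a + energy_potential g b) / 2
     - g / 4 * (jump (cell_B a) (cell_B b) \<bullet> (P (avg_h a b) *v jump (cell_u P a) (cell_u P b)))"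

text \<open>One bound for each side of the interface. They follow by writing the one-sided entropy
  variable as the average minus or plus half the jump and bounding the jump part by
  \<open>entropy_jump_ec_flux\<close>.\<close>

lemma entropy_var_es1_flux:
  fixes T \<Lambda>
  assumes "diagonal_mat (\<Lambda> a b)"
  defines "s \<equiv> P (avg_h a b) *v jump (cell_B a) (cell_B b)"
  shows "entropy_var P g a \<bullet> es1_flux P g T \<Lambda> a b \<ge>
      energy_flux g T \<Lambda> a b + energy_potential g a - g / 2 * (cell_u P a \<bullet> s)"
    and "entropy_var P g b \<bullet> es1_flux P g T \<Lambda> a b \<le>
      energy_flux g T \<Lambda> a b + energy_potential g b + g / 2 * (cell_u P b \<bullet> s)"
proof -
  let ?V = "entropy_var P g" and ?F = "es1_flux P g T \<Lambda> a b" and ?J = "jump (cell_B a) (cell_B b)"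
  let ?dV = "jump (?V a) (?V b)"
  \<comment> \<open>This is the only place where the diffusion contributes: its quadratic form is
    nonnegative.\<close>
  have "?dV \<bullet> ?F \<le> ?dV \<bullet> ec_flux P g a b"
    using inner_es1_matrix_nonneg[of \<Lambda> a b ?dV T] assms by (simp add: es1_flux_def inner_diff_right)
  then have dV: "?dV \<bullet> ?F \<le> energy_potential g b - energy_potential g a + g * (?J \<bullet> (P (avg_h a b) *v avg_u P a b))"
    by (simp only: entropy_jump_ec_flux)
  have sw: "?J \<bullet> (P (avg_h a b) *v x) = x \<bullet> s" for x
    unfolding s_def by (metis inner_left inner_commute)
  have a: "?V a \<bullet> ?F = avg (?V a) (?V b) \<bullet> ?F - (1/2) * (?dV \<bullet> ?F)"
    and b: "?V b \<bullet> ?F = avg (?V a) (?V b) \<bullet> ?F + (1/2) * (?dV \<bullet> ?F)"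
    by (simp_all add: avg_def jump_def inner_add_left inner_diff_left field_simps)
  have u: "g * (avg_u P a b \<bullet> s) = g / 2 * (cell_u P a \<bullet> s) + g / 2 * (cell_u P b \<bullet> s)"
    by (simp add: avg_u_def avg_def inner_add_left field_simps)
  have j: "g / 4 * (jump (cell_u P a) (cell_u P b) \<bullet> s) = (g / 2 * (cell_u P b \<bullet> s) - g / 2 * (cell_u P a \<bullet> s)) / 2"
    by (simp add: jump_def inner_diff_left field_simps)
  \<comment> \<open>Naming the nonlinear terms leaves pure linear arithmetic.\<close>
  define X where "X = g / 2 * (cell_u P a \<bullet> s)"
  define Y where "Y = g / 2 * (cell_u P b \<bullet> s)"
  define Z where "Z = ?dV \<bullet> ?F"
  note eqs = dV[unfolded sw u, folded X_def Y_def Z_def] a[folded Z_def]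
    b[folded Z_def] j[folded X_def Y_def]
  show "?V a \<bullet> ?F \<ge> energy_flux g T \<Lambda> a b + energy_potential g a - g / 2 * (cell_u P a \<bullet> s)"
    using eqs unfolding energy_flux_def s_def[symmetric] sw X_def[symmetric] by argo
  show "?V b \<bullet> ?F \<le> energy_flux g T \<Lambda> a b + energy_potential g b + g / 2 * (cell_u P b \<bullet> s)"
    using eqs unfolding energy_flux_def sw Y_def[symmetric] by argo
qed

text \<open>By the chain rule the energy rate is the entropy variable tested against the right-hand
  side. Cell \<open>i\<close> is the left cell of its right interface and the right cell of its left
  interface; subtracting the two one-sided bounds cancels its potential, and the two halves of the
  source cancel the bottom terms.\<close>

lemma energy_stable_es1:
  assumes diag: "\<And>a b. pos_def (P (cell_h a)) \<Longrightarrow> pos_def (P (cell_h b)) \<Longrightarrow> diagonal_mat (\<Lambda> a b)"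
  shows "energy_stable P g (es1_flux P g T \<Lambda>) (num_source P g)"
  unfolding energy_stable_def
proof (intro exI[of _ "energy_flux g T \<Lambda>"] allI impI ballI, elim conjE)
  fix \<Delta>x J I B U i t
  assume dx: "\<Delta>x > 0" and sol: "fv_solution P (es1_flux P g T \<Lambda>) (num_source P g) \<Delta>x J I B U"
    and i: "i \<in> interior_cells J" and t: "t \<in> I"
  let ?c = "\<lambda>j. (U j t, B j)" and ?V = "entropy_var P g (U i t, B i)"
  let ?F = "es1_flux P g T \<Lambda>" and ?H = "energy_flux g T \<Lambda>"
  let ?rhs = "fv_rhs ?F (num_source P g) \<Delta>x ?c i"
  let ?s = "\<lambda>a b. P (avg_h a b) *v jump (cell_B a) (cell_B b)"
  have J: "i \<in> J" "i - 1 \<in> J" "i + 1 \<in> J" using i by (auto simp: interior_cells_def)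
  have pd: "pos_def (P (cell_h (?c j)))" if "j \<in> J" for j
    using sol t that by (simp add: fv_solution_def cell_h_def)
  have "(U i has_vector_derivative ?rhs) (at t within I)"
    using sol i t by (simp add: fv_solution_def)
  then have "(U i has_derivative (\<lambda>x. x *\<^sub>R ?rhs)) (at t within I)"
    by (simp add: has_vector_derivative_def)
  moreover have "invertible (P (upper (U i t)))"
    using pos_def_invertible[OF pd[OF J(1)]] by (simp add: cell_h_def)
  ultimately have "((\<lambda>s. cell_energy P g (U i s, B i)) has_derivative (\<lambda>x. ?V \<bullet> (x *\<^sub>R ?rhs))) (at t within I)"
    by (rule has_derivative_compose[OF _ has_derivative_cell_energy])
  then have "((\<lambda>s. cell_energy P g (U i s, B i)) has_real_derivative ?V \<bullet> ?rhs) (at t within I)"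
    by (rule has_derivative_imp_has_field_derivative) simp
  moreover have "?V \<bullet> ?rhs \<le> - (1 / \<Delta>x) * (?H (?c i) (?c (i + 1)) - ?H (?c (i - 1)) (?c i))"
  proof -
    let ?R = "?F (?c i) (?c (i + 1))" and ?L = "?F (?c (i - 1)) (?c i)" and ?u = "cell_u P (?c i)"
    have src: "?V \<bullet> num_source P g \<Delta>x (?c (i - 1)) (?c i) (?c (i + 1))
        = - (1 / \<Delta>x) * (g / 2 * (?u \<bullet> ?s (?c i) (?c (i + 1))) + g / 2 * (?u \<bullet> ?s (?c (i - 1)) (?c i)))"
    proof -
      have "- (g / (2 * \<Delta>x)) * (p + q) = - (1 / \<Delta>x) * (g / 2 * p + g / 2 * q)" for p q
        by (simp add: distrib_left)
      then show ?thesis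
        unfolding num_source_def entropy_var_def stack_inner inner_minus_right inner_scaleR_right
          inner_add_right inner_zero_right by simp
    qed
    have "?V \<bullet> ?rhs = - (1 / \<Delta>x) * ((?V \<bullet> ?R + g / 2 * (?u \<bullet> ?s (?c i) (?c (i + 1))))
          - (?V \<bullet> ?L - g / 2 * (?u \<bullet> ?s (?c (i - 1)) (?c i))))"
      unfolding fv_rhs_def inner_add_right src inner_minus_right inner_scaleR_right inner_diff_right
      by argo
    also have "\<dots> \<le> - (1 / \<Delta>x) * (?H (?c i) (?c (i + 1)) - ?H (?c (i - 1)) (?c i))"
    proof (rule mult_left_mono_neg)
      have "?H (?c i) (?c (i + 1)) + energy_potential g (?c i) - g / 2 * (?u \<bullet> ?s (?c i) (?c (i + 1))) \<le> ?V \<bullet> ?R"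
        by (rule entropy_var_es1_flux(1)) (intro diag pd J)
      moreover have "?V \<bullet> ?L \<le> ?H (?c (i - 1)) (?c i) + energy_potential g (?c i) + g / 2 * (?u \<bullet> ?s (?c (i - 1)) (?c i))"
        by (rule entropy_var_es1_flux(2)) (intro diag pd J)
      ultimately show "?H (?c i) (?c (i + 1)) - ?H (?c (i - 1)) (?c i)
        \<le> (?V \<bullet> ?R + g / 2 * (?u \<bullet> ?s (?c i) (?c (i + 1)))) - (?V \<bullet> ?L - g / 2 * (?u \<bullet> ?s (?c (i - 1)) (?c i)))"
        by linarith
    qed (use dx in simp)
    finally show ?thesis .
  qed
  ultimately show "\<exists>E'. ((\<lambda>s. cell_energy P g (U i s, B i)) has_real_derivative E') (at t within I) \<and>
      E' \<le> - (1 / \<Delta>x) * (?H (?c i) (?c (i + 1)) - ?H (?c (i - 1)) (?c i))"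
    by blast
qed

end

subsection \<open>Uniformly bounded families of matrices\<close>

lemma
  fixes v :: "real^('k::finite + 'k)" and a b :: "real^'k"
  shows norm_upper_le: "norm (upper v) \<le> norm v"
    and norm_lower_le: "norm (lower v) \<le> norm v"
    and norm_stack_le: "norm (stack a b) \<le> norm a + norm b"
proof -
  have sq: "(norm v)\<^sup>2 = (norm (upper v))\<^sup>2 + (norm (lower v))\<^sup>2" for v :: "real^('k + 'k)"
    by (simp add: power2_norm_eq_inner inner_vec_def upper_def lower_def
        UNIV_Plus_UNIV[symmetric] sum.Plus del: UNIV_Plus_UNIV)
  show "norm (upper v) \<le> norm v" "norm (lower v) \<le> norm v"
    by (rule power2_le_imp_le; simp add: sq[of v])+
  show "norm (stack a b) \<le> norm a + norm b"
    by (rule power2_le_imp_le) (simp_all add: sq power2_sum)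
qed

text \<open>Positive definiteness with an explicit constant, so that it can hold uniformly over a
  family.\<close>

definition coercive :: "real \<Rightarrow> real^'n^'n \<Rightarrow> bool" where
  "coercive \<alpha> A \<longleftrightarrow> (\<forall>x. \<alpha> * (norm x)\<^sup>2 \<le> x \<bullet> (A *v x))"

lemma coercive_norm_le:
  assumes "coercive \<alpha> A"
  shows "\<alpha> * norm x \<le> norm (A *v x)"
proof (cases "x = 0")
  case False
  have "\<alpha> * (norm x)\<^sup>2 \<le> x \<bullet> (A *v x)" using assms by (simp add: coercive_def)
  also have "\<dots> \<le> norm x * norm (A *v x)" by (rule norm_cauchy_schwarz)
  finally have "norm x * (\<alpha> * norm x) \<le> norm x * norm (A *v x)" by (simp add: power2_eq_square mult_ac)
  then show ?thesis using False by simp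
qed simp

text \<open>A uniform operator norm bound, eventually along the filter. It asks for no limit or
  continuity in \<open>p\<close>, as the chosen eigenvectors may jump.\<close>

definition op_bounded :: "'p filter \<Rightarrow> ('p \<Rightarrow> real^'n^'m) \<Rightarrow> bool" where
  "op_bounded F A \<longleftrightarrow> (\<exists>C\<ge>0. \<forall>\<^sub>F p in F. \<forall>x. norm (A p *v x) \<le> C * norm x)"

lemma op_boundedI:
  assumes "\<forall>\<^sub>F p in F. \<forall>x. norm (A p *v x) \<le> C * norm x"
  shows "op_bounded F A"
  unfolding op_bounded_def
proof (intro exI conjI)
  show "\<forall>\<^sub>F p in F. \<forall>x. norm (A p *v x) \<le> max C 0 * norm x"
    using assms by (rule eventually_mono)
      (meson dual_order.trans max.cobounded1 mult_right_mono norm_ge_zero)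
qed simp

lemma op_boundedE:
  assumes "op_bounded F A"
  obtains C where "C \<ge> 0" "\<forall>\<^sub>F p in F. \<forall>x. norm (A p *v x) \<le> C * norm x"
  using assms unfolding op_bounded_def by blast

lemma op_bounded_cong:
  assumes "op_bounded F A" "\<forall>\<^sub>F p in F. A p = B p"
  shows "op_bounded F B"
proof -
  obtain C where "\<forall>\<^sub>F p in F. \<forall>x. norm (A p *v x) \<le> C * norm x"
    using assms(1) by (auto simp: op_bounded_def)
  then have "\<forall>\<^sub>F p in F. \<forall>x. norm (B p *v x) \<le> C * norm x"
    using assms(2) by eventually_elim simp
  then show ?thesis by (rule op_boundedI)
qed

lemma op_bounded_add:
  assumes "op_bounded F A" "op_bounded F B"
  shows "op_bounded F (\<lambda>p. A p + B p)"
proof -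
  obtain a b where "\<forall>\<^sub>F p in F. \<forall>x. norm (A p *v x) \<le> a * norm x" "\<forall>\<^sub>F p in F. \<forall>x. norm (B p *v x) \<le> b * norm x"
    using assms by (auto simp: op_bounded_def)
  then have "\<forall>\<^sub>F p in F. \<forall>x. norm ((A p + B p) *v x) \<le> (a + b) * norm x"
    by eventually_elim
      (metis (no_types, lifting) matrix_vector_mult_add_rdistrib norm_triangle_le add_mono distrib_right)
  then show ?thesis by (rule op_boundedI)
qed

lemma op_bounded_scaleR:
  assumes "op_bounded F A"
  shows "op_bounded F (\<lambda>p. c *\<^sub>R A p)"
proof -
  obtain a where "\<forall>\<^sub>F p in F. \<forall>x. norm (A p *v x) \<le> a * norm x"
    using assms by (auto simp: op_bounded_def)
  then have "\<forall>\<^sub>F p in F. \<forall>x. norm ((c *\<^sub>R A p) *v x) \<le> (\<bar>c\<bar> * a) * norm x"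
    by eventually_elim (simp add: scaleR_matrix_vector_assoc[symmetric] mult.assoc mult_left_mono)
  then show ?thesis by (rule op_boundedI)
qed

lemma op_bounded_diff:
  assumes "op_bounded F A" "op_bounded F B"
  shows "op_bounded F (\<lambda>p. A p - B p)"
  using op_bounded_add[OF assms(1) op_bounded_scaleR[OF assms(2), of "-1"]] by simp

lemma op_bounded_mult:
  assumes "op_bounded F A" "op_bounded F B"
  shows "op_bounded F (\<lambda>p. A p ** B p)"
proof -
  obtain a b where a: "a \<ge> 0" "\<forall>\<^sub>F p in F. \<forall>x. norm (A p *v x) \<le> a * norm x"
    and b: "\<forall>\<^sub>F p in F. \<forall>x. norm (B p *v x) \<le> b * norm x"
    using assms by (auto simp: op_bounded_def)
  have "\<forall>\<^sub>F p in F. \<forall>x. norm ((A p ** B p) *v x) \<le> (a * b) * norm x"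
    using a(2) b
  proof eventually_elim
    case (elim p)
    show ?case
    proof
      fix x
      have "norm (A p *v (B p *v x)) \<le> a * norm (B p *v x)" using elim by blast
      also have "\<dots> \<le> a * (b * norm x)" using elim a(1) by (intro mult_left_mono) auto
      finally show "norm ((A p ** B p) *v x) \<le> (a * b) * norm x"
        by (simp add: matrix_vector_mul_assoc mult.assoc)
    qed
  qed
  then show ?thesis by (rule op_boundedI)
qed

text \<open>With \<open>y = transpose A *v x\<close>, the squared norm of \<open>y\<close> is
  \<open>x \<bullet> (A *v y)\<close>; Cauchy-Schwarz and division by the norm of \<open>y\<close>
  give the same constant as for \<open>A\<close>.\<close>

lemma op_bounded_transpose:
  fixes A :: "'p \<Rightarrow> real^'n^'m"
  assumes "op_bounded F A"
  shows "op_bounded F (\<lambda>p. transpose (A p))"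
proof -
  obtain a where "\<forall>\<^sub>F p in F. \<forall>x. norm (A p *v x) \<le> a * norm x"
    using assms by (auto simp: op_bounded_def)
  then have "\<forall>\<^sub>F p in F. \<forall>x. norm (transpose (A p) *v x) \<le> a * norm x"
  proof eventually_elim
    case (elim p)
    show ?case
    proof
      fix x
      let ?y = "transpose (A p) *v x"
      have "norm ?y * norm ?y = x \<bullet> (A p *v ?y)"
        by (simp add: dot_lmul_matrix[symmetric] flip: power2_eq_square power2_norm_eq_inner)
      also have "\<dots> \<le> norm x * norm (A p *v ?y)" by (rule norm_cauchy_schwarz)
      also have "\<dots> \<le> norm x * (a * norm ?y)" using elim by (intro mult_left_mono) auto
      finally have "norm ?y * norm ?y \<le> norm ?y * (a * norm x)" by (simp add: mult_ac)
      \<comment> \<open>No sign of \<open>a\<close> was recorded; testing its bound on a unit vector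
        supplies it for the case \<open>?y = 0\<close>.\<close>
      moreover have "0 \<le> a * norm x"
        using elim[rule_format, of "axis undefined 1"] by (simp add: order_trans[OF norm_ge_zero])
      ultimately show "norm ?y \<le> a * norm x"
        by (cases "norm ?y = 0") (auto simp: mult_le_cancel_left)
    qed
  qed
  then show ?thesis by (rule op_boundedI)
qed

lemma op_bounded_mat_1: "op_bounded F (\<lambda>p. mat 1)"
  by (rule op_boundedI[where C = 1]) simp

lemma op_bounded_orthogonal:
  fixes L :: "'p \<Rightarrow> real^'n^'n"
  assumes "\<forall>\<^sub>F p in F. orthogonal_matrix (L p)"
  shows "op_bounded F L"
proof (rule op_boundedI[where C = 1])
  show "\<forall>\<^sub>F p in F. \<forall>x. norm (L p *v x) \<le> 1 * norm x"
    using assms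
  proof eventually_elim
    case (elim p)
    then have "orthogonal_transformation ((*v) (L p))"
      by (simp add: orthogonal_transformation_matrix)
    then show ?case by (simp add: orthogonal_transformation)
  qed
qed

lemma op_bounded_block_mat:
  fixes A B C D :: "'p \<Rightarrow> real^'k::finite^'k"
  assumes "op_bounded F A" "op_bounded F B" "op_bounded F C" "op_bounded F D"
  shows "op_bounded F (\<lambda>p. block_mat (A p) (B p) (C p) (D p))"
proof -
  obtain a b c d where pos: "a \<ge> 0" "b \<ge> 0" "c \<ge> 0" "d \<ge> 0"
    and ev: "\<forall>\<^sub>F p in F. \<forall>x. norm (A p *v x) \<le> a * norm x" "\<forall>\<^sub>F p in F. \<forall>x. norm (B p *v x) \<le> b * norm x"
      "\<forall>\<^sub>F p in F. \<forall>x. norm (C p *v x) \<le> c * norm x" "\<forall>\<^sub>F p in F. \<forall>x. norm (D p *v x) \<le> d * norm x"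
    using assms by (auto simp: op_bounded_def)
  from ev have "\<forall>\<^sub>F p in F. \<forall>x. norm (block_mat (A p) (B p) (C p) (D p) *v x) \<le> (a + b + c + d) * norm x"
  proof eventually_elim
    case (elim p)
    show ?case
    proof
      fix x :: "real^('k + 'k)"
      let ?u = "upper x" and ?l = "lower x"
      have "block_mat (A p) (B p) (C p) (D p) *v x
          = stack (A p *v ?u + B p *v ?l) (C p *v ?u + D p *v ?l)"
        using block_mat_stack[of "A p" "B p" "C p" "D p" ?u ?l] by simp
      also have "norm \<dots> \<le> (norm (A p *v ?u) + norm (B p *v ?l)) + (norm (C p *v ?u) + norm (D p *v ?l))"
        by (intro order_trans[OF norm_stack_le] add_mono norm_triangle_ineq)
      also have "\<dots> \<le> (a * norm x + b * norm x) + (c * norm x + d * norm x)"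
        using elim pos
        by (intro add_mono) (meson mult_left_mono norm_upper_le norm_lower_le order_trans)+
      finally show "norm (block_mat (A p) (B p) (C p) (D p) *v x) \<le> (a + b + c + d) * norm x"
        by (simp add: algebra_simps)
    qed
  qed
  then show ?thesis by (rule op_boundedI)
qed

text \<open>As \<open>G\<close> is symmetric with square \<open>A\<close>, the squared norm of
  \<open>G *v x\<close> is \<open>x \<bullet> (A *v x)\<close>.\<close>

lemma op_bounded_sqrt:
  fixes G A :: "'p \<Rightarrow> real^'n^'n"
  assumes A: "op_bounded F A" and G: "\<forall>\<^sub>F p in F. pos_def (G p) \<and> G p ** G p = A p"
  shows "op_bounded F G"
proof -
  obtain a where a: "a \<ge> 0" "\<forall>\<^sub>F p in F. \<forall>x. norm (A p *v x) \<le> a * norm x"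
    using A by (auto simp: op_bounded_def)
  from a(2) G have "\<forall>\<^sub>F p in F. \<forall>x. norm (G p *v x) \<le> sqrt a * norm x"
  proof eventually_elim
    case (elim p)
    show ?case
    proof
      fix x
      have "(norm (G p *v x))\<^sup>2 = x \<bullet> (A p *v x)"
        using elim(2) unfolding power2_norm_eq_inner
        by (metis dot_lmul_matrix matrix_vector_mul_assoc pos_def_def transpose_matrix_vector)
      also have "\<dots> \<le> norm x * norm (A p *v x)" by (rule norm_cauchy_schwarz)
      also have "\<dots> \<le> norm x * (a * norm x)" using elim by (intro mult_left_mono) auto
      also have "\<dots> = (sqrt a * norm x)\<^sup>2" using a(1) by (simp add: power2_eq_square mult_ac)
      finally show "norm (G p *v x) \<le> sqrt a * norm x"
        by (rule power2_le_imp_le) (simp add: a(1))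
    qed
  qed
  then show ?thesis by (rule op_boundedI)
qed

text \<open>The identity behind \<open>op_bounded_sqrt\<close>, read from below at
  \<open>y = matrix_inv G *v x\<close>: coercivity of \<open>A\<close> bounds \<open>y\<close> by
  \<open>G *v y = x\<close>.\<close>

lemma op_bounded_inv_sqrt:
  fixes G A :: "'p \<Rightarrow> real^'n^'n"
  assumes \<alpha>: "\<alpha> > 0" and A: "\<forall>\<^sub>F p in F. coercive \<alpha> (A p)"
    and G: "\<forall>\<^sub>F p in F. pos_def (G p) \<and> G p ** G p = A p"
  shows "op_bounded F (\<lambda>p. matrix_inv (G p))"
proof -
  from A G have "\<forall>\<^sub>F p in F. \<forall>x. norm (matrix_inv (G p) *v x) \<le> (1 / sqrt \<alpha>) * norm x"
  proof eventually_elim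
    case (elim p)
    show ?case
    proof
      fix x
      let ?y = "matrix_inv (G p) *v x"
      have "(sqrt \<alpha> * norm ?y)\<^sup>2 = \<alpha> * (norm ?y)\<^sup>2" using \<alpha> by (simp add: power_mult_distrib)
      also have "\<dots> \<le> ?y \<bullet> (A p *v ?y)" using elim by (simp add: coercive_def)
      also have "\<dots> = (norm (G p *v ?y))\<^sup>2"
        using elim(2) unfolding power2_norm_eq_inner
        by (metis dot_lmul_matrix matrix_vector_mul_assoc pos_def_def transpose_matrix_vector)
      also have "G p *v ?y = x" using elim(2) by (simp add: matrix_inv_mult_vec pos_def_invertible)
      finally have "sqrt \<alpha> * norm ?y \<le> norm x" by (rule power2_le_imp_le) simp
      then show "norm ?y \<le> (1 / sqrt \<alpha>) * norm x" using \<alpha> by (simp add: field_simps)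
    qed
  qed
  then show ?thesis by (rule op_boundedI)
qed

text \<open>For a diagonal matrix, absolute values only change signs of the components of the image,
  so its norm is unchanged.\<close>

lemma op_bounded_abs_mat:
  assumes D: "op_bounded F D" and diag: "\<forall>\<^sub>F p in F. diagonal_mat (D p)"
  shows "op_bounded F (\<lambda>p. abs_mat (D p))"
proof -
  obtain C where "\<forall>\<^sub>F p in F. \<forall>x. norm (D p *v x) \<le> C * norm x"
    using D by (auto simp: op_bounded_def)
  with diag have "\<forall>\<^sub>F p in F. \<forall>x. norm (abs_mat (D p) *v x) \<le> C * norm x"
  proof eventually_elim
    case (elim p)
    have "norm (abs_mat (D p) *v x) = norm (D p *v x)" for x
      unfolding norm_vec_def L2_set_def
      by (simp add: diagonal_mat_mult diagonal_mat_abs_mat elim(1) power_mult_distrib)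
        (simp add: abs_mat_def)
    then show ?case using elim(2) by simp
  qed
  then show ?thesis by (rule op_boundedI)
qed

subsection \<open>Agreement to first order in a small parameter\<close>

text \<open>In the application \<open>p\<close> is a pair of mesh width and position, and
  \<open>d p\<close> is the mesh width.\<close>

locale small_parameter =
  fixes F :: "'p filter" and d :: "'p \<Rightarrow> real"
  assumes tendsto_0: "(d \<longlongrightarrow> 0) F" and nonneg: "\<forall>\<^sub>F p in F. d p \<ge> 0"
begin

text \<open>Boundedness of the limit family is part of the relation so that it is preserved by products.\<close>

definition close :: "('p \<Rightarrow> 'a::real_normed_vector) \<Rightarrow> ('p \<Rightarrow> 'a) \<Rightarrow> bool" where
  "close f f0 \<longleftrightarrow> Bfun f0 F \<and> (\<exists>C. \<forall>\<^sub>F p in F. norm (f p - f0 p) \<le> C * d p)"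

lemma closeI:
  assumes "Bfun f0 F" "\<forall>\<^sub>F p in F. norm (f p - f0 p) \<le> C * d p"
  shows "close f f0"
  using assms by (auto simp: close_def)

lemma closeE:
  assumes "close f f0"
  obtains C where "C \<ge> 0" "\<forall>\<^sub>F p in F. norm (f p - f0 p) \<le> C * d p"
proof -
  obtain C where "\<forall>\<^sub>F p in F. norm (f p - f0 p) \<le> C * d p"
    using assms by (auto simp: close_def)
  then have "\<forall>\<^sub>F p in F. norm (f p - f0 p) \<le> max C 0 * d p"
    using nonneg by eventually_elim (meson max.cobounded1 mult_right_mono order_trans)
  then show ?thesis using that[of "max C 0"] by simp
qed

lemma close_Bfun_right: "close f f0 \<Longrightarrow> Bfun f0 F"
  by (simp add: close_def)

lemma close_tendsto:
  assumes "close f f0"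
  shows "((\<lambda>p. f p - f0 p) \<longlongrightarrow> 0) F"
proof -
  obtain C where C: "\<forall>\<^sub>F p in F. norm (f p - f0 p) \<le> C * d p"
    using assms by (auto simp: close_def)
  have "((\<lambda>p. C * d p) \<longlongrightarrow> 0) F" using tendsto_mult_right_zero[OF tendsto_0] .
  then show ?thesis by (rule Lim_null_comparison[OF C])
qed

lemma close_Bfun_left:
  assumes "close f f0"
  shows "Bfun f F"
proof -
  have "\<forall>\<^sub>F p in F. norm (f p - f0 p) < 1"
    using tendstoD[OF close_tendsto[OF assms], of 1] by simp
  moreover obtain K where K: "\<forall>\<^sub>F p in F. norm (f0 p) \<le> K"
    using close_Bfun_right[OF assms] by (auto simp: Bfun_def)
  ultimately have "\<forall>\<^sub>F p in F. norm (f p) \<le> K + 1"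
  proof eventually_elim
    case (elim p)
    then show ?case using norm_triangle_sub[of "f p" "f0 p"] by simp
  qed
  then show ?thesis by (rule BfunI)
qed

lemma close_refl: "Bfun f F \<Longrightarrow> close f f"
  by (rule closeI[of _ _ 0]) simp_all

lemma close_cong:
  assumes "close f f0" "\<forall>\<^sub>F p in F. f p = h p" "\<forall>\<^sub>F p in F. f0 p = h0 p"
  shows "close h h0"
proof -
  obtain C where C: "\<forall>\<^sub>F p in F. norm (f p - f0 p) \<le> C * d p"
    using assms(1) by (auto simp: close_def)
  obtain K where K: "\<forall>\<^sub>F p in F. norm (f0 p) \<le> K"
    using close_Bfun_right[OF assms(1)] by (auto simp: Bfun_def)
  show ?thesis
  proof (rule closeI)
    show "Bfun h0 F" using assms(3) K by (intro BfunI[of _ K], eventually_elim) simp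
    show "\<forall>\<^sub>F p in F. norm (h p - h0 p) \<le> C * d p" using C assms(2,3) by eventually_elim simp
  qed
qed

lemma Bfun_bilinear:
  assumes "bounded_bilinear pr" "Bfun a F" "Bfun b F"
  shows "Bfun (\<lambda>p. pr (a p) (b p)) F"
proof -
  interpret bounded_bilinear pr by fact
  obtain K where K: "K \<ge> 0" "\<And>a b. norm (pr a b) \<le> norm a * norm b * K" using nonneg_bounded by blast
  obtain A B where A: "A > 0" "\<forall>\<^sub>F p in F. norm (a p) \<le> A" and B: "\<forall>\<^sub>F p in F. norm (b p) \<le> B"
    using assms(2,3) by (auto simp: Bfun_def)
  from A(2) B have "\<forall>\<^sub>F p in F. norm (pr (a p) (b p)) \<le> A * B * K"
    by eventually_elim
      (intro order_trans[OF K(2)] mult_right_mono mult_mono; use A(1) K(1) in simp)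
  then show ?thesis by (rule BfunI)
qed

lemma close_bilinear:
  assumes "bounded_bilinear pr" "close a a0" "close b b0"
  shows "close (\<lambda>p. pr (a p) (b p)) (\<lambda>p. pr (a0 p) (b0 p))"
proof -
  interpret bounded_bilinear pr by fact
  obtain K where K: "K \<ge> 0" "\<And>a b. norm (pr a b) \<le> norm a * norm b * K" using nonneg_bounded by blast
  obtain A where A: "A > 0" "\<forall>\<^sub>F p in F. norm (a0 p) \<le> A"
    using close_Bfun_right[OF assms(2)] by (auto simp: Bfun_def)
  obtain B where B: "B > 0" "\<forall>\<^sub>F p in F. norm (b p) \<le> B"
    using close_Bfun_left[OF assms(3)] by (auto simp: Bfun_def)
  obtain Ca where Ca: "Ca \<ge> 0" "\<forall>\<^sub>F p in F. norm (a p - a0 p) \<le> Ca * d p"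
    using closeE[OF assms(2)] .
  obtain Cb where Cb: "Cb \<ge> 0" "\<forall>\<^sub>F p in F. norm (b p - b0 p) \<le> Cb * d p"
    using closeE[OF assms(3)] .
  show ?thesis
  proof (rule closeI)
    show "Bfun (\<lambda>p. pr (a0 p) (b0 p)) F"
      by (rule Bfun_bilinear[OF assms(1) close_Bfun_right[OF assms(2)] close_Bfun_right[OF assms(3)]])
    show "\<forall>\<^sub>F p in F. norm (pr (a p) (b p) - pr (a0 p) (b0 p)) \<le> (Ca * B * K + A * Cb * K) * d p"
      using A(2) B(2) Ca(2) Cb(2) nonneg
    proof eventually_elim
      case (elim p)
      have "pr (a p) (b p) - pr (a0 p) (b0 p) = pr (a p - a0 p) (b p) + pr (a0 p) (b p - b0 p)"
        by (simp add: diff_left diff_right)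
      also have "norm \<dots> \<le> norm (a p - a0 p) * norm (b p) * K + norm (a0 p) * norm (b p - b0 p) * K"
        by (intro norm_triangle_le add_mono K(2))
      also have "\<dots> \<le> (Ca * d p) * B * K + A * (Cb * d p) * K"
        using elim A(1) B(1) K(1) Ca(1) Cb(1)
        by (intro add_mono mult_right_mono mult_mono) auto
      finally show ?case by (simp add: algebra_simps)
    qed
  qed
qed

lemma close_linear:
  assumes "bounded_linear L" "close f f0"
  shows "close (\<lambda>p. L (f p)) (\<lambda>p. L (f0 p))"
proof -
  \<comment> \<open>A linear map is treated as a bilinear one whose first factor is the constant
    1.\<close>
  have "bounded_bilinear (\<lambda>(x::real) y. x *\<^sub>R L y)"
    using bounded_bilinear.comp[OF bounded_bilinear_scaleR bounded_linear_ident assms(1)] .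
  from close_bilinear[OF this close_refl[OF Bfun_const, of 1] assms(2)] show ?thesis by simp
qed

lemma close_add:
  assumes "close a a0" "close b b0"
  shows "close (\<lambda>p. a p + b p) (\<lambda>p. a0 p + b0 p)"
proof -
  obtain A where A: "\<forall>\<^sub>F p in F. norm (a0 p) \<le> A"
    using close_Bfun_right[OF assms(1)] by (auto simp: Bfun_def)
  obtain B where B: "\<forall>\<^sub>F p in F. norm (b0 p) \<le> B"
    using close_Bfun_right[OF assms(2)] by (auto simp: Bfun_def)
  obtain Ca where Ca: "\<forall>\<^sub>F p in F. norm (a p - a0 p) \<le> Ca * d p"
    using assms(1) by (auto simp: close_def)
  obtain Cb where Cb: "\<forall>\<^sub>F p in F. norm (b p - b0 p) \<le> Cb * d p"
    using assms(2) by (auto simp: close_def)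
  show ?thesis
  proof (rule closeI)
    show "Bfun (\<lambda>p. a0 p + b0 p) F"
      using A B by (intro BfunI[of _ "A + B"], eventually_elim) (rule norm_triangle_mono)
    show "\<forall>\<^sub>F p in F. norm (a p + b p - (a0 p + b0 p)) \<le> (Ca + Cb) * d p"
      using Ca Cb by eventually_elim (simp add: add_diff_add distrib_right norm_triangle_mono)
  qed
qed

lemma close_scaleR: "close a a0 \<Longrightarrow> close (\<lambda>p. c *\<^sub>R a p) (\<lambda>p. c *\<^sub>R a0 p)"
  by (rule close_linear[OF bounded_linear_scaleR_right])

lemma close_minus: "close a a0 \<Longrightarrow> close (\<lambda>p. - a p) (\<lambda>p. - a0 p)"
  using close_scaleR[of a a0 "-1"] by simp

lemma close_diff: "close a a0 \<Longrightarrow> close b b0 \<Longrightarrow> close (\<lambda>p. a p - b p) (\<lambda>p. a0 p - b0 p)"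
  using close_add[OF _ close_minus, of a a0 b b0] by simp

lemma close_stack:
  fixes a b :: "'p \<Rightarrow> real^'k::finite"
  assumes "close a a0" "close b b0"
  shows "close (\<lambda>p. stack (a p) (b p)) (\<lambda>p. stack (a0 p) (b0 p))"
proof -
  have "bounded_linear (\<lambda>b. stack 0 b :: real^('k+'k))" "bounded_linear (\<lambda>a. stack a 0 :: real^('k+'k))"
    by (auto simp: linear_conv_bounded_linear[symmetric] stack_def vec_eq_iff intro!: linearI split: sum.splits)
  from close_add[OF close_linear[OF this(2) assms(1)] close_linear[OF this(1) assms(2)]]
  show ?thesis by (simp add: stack_linear)
qed

text \<open>The operators need only be bounded, not convergent, since they act on a vector that is
  itself of first order. This is how the diffusion is handled.\<close>

lemma close_op_bounded_0:
  assumes A: "op_bounded F A" and v: "close v (\<lambda>p. 0)"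
  shows "close (\<lambda>p. A p *v v p) (\<lambda>p. 0)"
proof -
  obtain a where a: "a \<ge> 0" "\<forall>\<^sub>F p in F. \<forall>x. norm (A p *v x) \<le> a * norm x"
    using A by (rule op_boundedE)
  obtain C where C: "\<forall>\<^sub>F p in F. norm (v p - 0) \<le> C * d p"
    using v by (auto simp: close_def)
  show ?thesis
  proof (rule closeI)
    show "\<forall>\<^sub>F p in F. norm (A p *v v p - 0) \<le> (a * C) * d p"
      using a(2) C
    proof eventually_elim
      case (elim p)
      have "norm (A p *v v p) \<le> a * norm (v p)" using elim by blast
      also have "\<dots> \<le> a * (C * d p)" using elim a(1) by (intro mult_left_mono) auto
      finally show ?case by simp
    qed
  qed simp
qed

end

lemma eventually_choice:
  assumes "\<forall>\<^sub>F p in F. \<exists>y. Q p y"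
  obtains f where "\<forall>\<^sub>F p in F. Q p (f p)"
proof
  show "\<forall>\<^sub>F p in F. Q p (SOME y. Q p y)"
    using assms by (rule eventually_mono) (rule someI_ex)
qed

section \<open>First order perturbation of velocity, flux and source\<close>

locale sg_small_parameter = sg_matrix P + small_parameter F d
  for P :: "real^'k::finite \<Rightarrow> real^'k^'k" and F :: "'p filter" and d :: "'p \<Rightarrow> real"
begin

lemmas close_prod = close_bilinear[OF bilinear]
lemmas close_upper = close_linear[OF bounded_linear_upper]
lemmas close_lower = close_linear[OF bounded_linear_lower]

lemma op_bounded_P:
  assumes "Bfun h F"
  shows "op_bounded F (\<lambda>p. P (h p))"
proof -
  obtain K where K: "K \<ge> 0" "\<And>a b. norm (P a *v b) \<le> norm a * norm b * K" using prod.nonneg_bounded by blast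
  obtain H where H: "\<forall>\<^sub>F p in F. norm (h p) \<le> H" using assms by (auto simp: Bfun_def)
  then have "\<forall>\<^sub>F p in F. \<forall>x. norm (P (h p) *v x) \<le> (H * K) * norm x"
  proof eventually_elim
    case (elim p)
    show ?case
    proof
      fix x
      have "norm (P (h p) *v x) \<le> norm (h p) * norm x * K" by (rule K(2))
      also have "\<dots> \<le> H * norm x * K" using elim K(1) by (intro mult_right_mono) auto
      finally show "norm (P (h p) *v x) \<le> (H * K) * norm x" by (simp add: mult_ac)
    qed
  qed
  then show ?thesis by (rule op_boundedI)
qed

lemma close_coercive:
  assumes \<alpha>: "\<alpha> > 0" and co: "\<forall>\<^sub>F p in F. coercive \<alpha> (P (h0 p))" and h: "close h h0"
  shows "\<forall>\<^sub>F p in F. coercive (\<alpha> / 2) (P (h p))"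
proof -
  obtain K where K: "K > 0" "\<And>a b. norm (P a *v b) \<le> norm a * norm b * K" using prod.pos_bounded by blast
  \<comment> \<open>At this distance the perturbation changes the quadratic form by at most half of
    the coercivity constant; \<open>K\<close> bounds the bilinear product.\<close>
  have "\<forall>\<^sub>F p in F. norm (h p - h0 p) < \<alpha> / (2 * K)"
    using tendstoD[OF close_tendsto[OF h], of "\<alpha> / (2 * K)"] \<alpha> K(1) by simp
  then show ?thesis
    using co
  proof eventually_elim
    case (elim p)
    have "\<alpha> / 2 * (norm x)\<^sup>2 \<le> x \<bullet> (P (h p) *v x)" for x
    proof -
      have "\<bar>x \<bullet> (P (h p - h0 p) *v x)\<bar> \<le> norm x * norm (P (h p - h0 p) *v x)"
        by (rule Cauchy_Schwarz_ineq2)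
      also have "\<dots> \<le> norm x * (norm (h p - h0 p) * norm x * K)"
        by (intro mult_left_mono K(2)) simp
      also have "\<dots> = (norm (h p - h0 p) * K) * (norm x)\<^sup>2" by (simp add: power2_eq_square)
      also have "\<dots> \<le> \<alpha> / 2 * (norm x)\<^sup>2"
        using elim(1) K(1) by (intro mult_right_mono) (simp_all add: field_simps)
      finally have "\<bar>x \<bullet> (P (h p - h0 p) *v x)\<bar> \<le> \<alpha> / 2 * (norm x)\<^sup>2" .
      moreover have "\<alpha> * (norm x)\<^sup>2 \<le> x \<bullet> (P (h0 p) *v x)" using elim(2) by (simp add: coercive_def)
      moreover have "x \<bullet> (P (h p) *v x) = x \<bullet> (P (h0 p) *v x) + x \<bullet> (P (h p - h0 p) *v x)"
        by (simp add: prod.diff_left inner_diff_right)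
      ultimately show ?thesis by argo
    qed
    then show ?case by (simp add: coercive_def)
  qed
qed

lemma coercive_pos_def:
  assumes "\<alpha> > 0" "coercive \<alpha> (P h)"
  shows "pos_def (P h)"
proof -
  have "x \<bullet> (P h *v x) > 0" if "x \<noteq> 0" for x
  proof -
    have "0 < \<alpha> * (norm x)\<^sup>2" using assms(1) that by simp
    also have "\<dots> \<le> x \<bullet> (P h *v x)" using assms(2) by (simp add: coercive_def)
    finally show ?thesis .
  qed
  then show ?thesis by (simp add: pos_def_def symmetric)
qed

text \<open>Stability of linear systems: the error solves a system with matrix
  \<open>P (h p)\<close>, coercive with constant \<open>\<alpha> / 2\<close>, and a right-hand side
  of first order.\<close>

lemma close_matrix_inv:
  assumes \<alpha>: "\<alpha> > 0" and co: "\<forall>\<^sub>F p in F. coercive \<alpha> (P (h0 p))"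
    and h: "close h h0" and q: "close q q0"
  shows "close (\<lambda>p. matrix_inv (P (h p)) *v q p) (\<lambda>p. matrix_inv (P (h0 p)) *v q0 p)"
proof -
  let ?u = "\<lambda>p. matrix_inv (P (h p)) *v q p" and ?v = "\<lambda>p. matrix_inv (P (h0 p)) *v q0 p"
  obtain K where K: "K > 0" "\<And>a b. norm (P a *v b) \<le> norm a * norm b * K" using prod.pos_bounded by blast
  obtain Q where Q: "\<forall>\<^sub>F p in F. norm (q0 p) \<le> Q"
    using close_Bfun_right[OF q] by (auto simp: Bfun_def)
  from co Q have u0: "\<forall>\<^sub>F p in F. norm (?v p) \<le> Q / \<alpha>"
  proof eventually_elim
    case (elim p)
    have "\<alpha> * norm (?v p) \<le> norm (q0 p)"
      using coercive_norm_le[OF elim(1), of "?v p"] coercive_pos_def[OF \<alpha> elim(1)]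
      by (simp add: matrix_inv_mult_vec pos_def_invertible)
    then show ?case using elim(2) \<alpha> by (simp add: field_simps)
  qed
  obtain Ch where Ch: "Ch \<ge> 0" "\<forall>\<^sub>F p in F. norm (h p - h0 p) \<le> Ch * d p" using closeE[OF h] .
  obtain Cq where Cq: "\<forall>\<^sub>F p in F. norm (q p - q0 p) \<le> Cq * d p" using closeE[OF q] .
  show ?thesis
  proof (rule closeI)
    show "Bfun ?v F" using u0 by (rule BfunI)
    show "\<forall>\<^sub>F p in F. norm (?u p - ?v p) \<le> ((Cq + Ch * (Q / \<alpha>) * K) / (\<alpha> / 2)) * d p"
      using u0 Ch(2) Cq nonneg co close_coercive[OF \<alpha> co h]
    proof eventually_elim
      case (elim p)
      have inv: "invertible (P (h p))" "invertible (P (h0 p))"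
        using coercive_pos_def[OF \<alpha> elim(5)] coercive_pos_def[OF _ elim(6)] \<alpha>
        by (auto intro: pos_def_invertible)
      have "\<alpha> / 2 * norm (?u p - ?v p) \<le> norm (P (h p) *v (?u p - ?v p))"
        by (rule coercive_norm_le[OF elim(6)])
      \<comment> \<open>Difference of the two systems; the mismatch of the matrices falls on
        \<open>?v\<close>, already bounded by \<open>Q / \<alpha>\<close>.\<close>
      also have "P (h p) *v (?u p - ?v p) = (q p - q0 p) - P (h p - h0 p) *v ?v p"
        unfolding prod.diff_right prod.diff_left matrix_inv_mult_vec(1)[OF inv(1)]
          matrix_inv_mult_vec(1)[OF inv(2)] by (simp only: diff_diff_eq2 diff_add_cancel)
      also have "norm \<dots> \<le> norm (q p - q0 p) + norm (P (h p - h0 p) *v ?v p)"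
        by (rule norm_triangle_ineq4)
      also have "\<dots> \<le> Cq * d p + norm (h p - h0 p) * norm (?v p) * K"
        using elim(3) K(2) by (rule add_mono)
      also have "\<dots> \<le> Cq * d p + (Ch * d p) * (Q / \<alpha>) * K"
        using elim Ch(1) K(1) by (intro add_left_mono mult_right_mono mult_mono) auto
      finally have "\<alpha> / 2 * norm (?u p - ?v p) \<le> (Cq + Ch * (Q / \<alpha>) * K) * d p"
        by (simp add: algebra_simps)
      then show ?case using \<alpha> by (simp add: field_simps)
    qed
  qed
qed

text \<open>Boundedness of \<open>h\<close> controls \<open>G\<close>, and coercivity controls its
  inverse; hence \<open>R\<close> and \<open>D\<close> are bounded, and the orthogonal
  \<open>L\<close> transfers these bounds to \<open>T\<close> and \<open>\<Lambda>\<close>.\<close>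

lemma op_bounded_es1_matrix:
  assumes g: "g > 0" and \<alpha>: "\<alpha> > 0"
    and co: "\<forall>\<^sub>F p in F. coercive \<alpha> (P (h p))" and h: "Bfun h F" and u: "Bfun u F"
    and eig: "\<forall>\<^sub>F p in F. roe_eigendecomposition P g (h p) (u p) (T p) (\<Lambda> p)"
  shows "op_bounded F (\<lambda>p. T p ** abs_mat (\<Lambda> p) ** transpose (T p))"
proof -
  have "\<forall>\<^sub>F p in F. \<exists>G L. pos_def G \<and> G ** G = g *\<^sub>R P (h p) \<and> orthogonal_matrix L \<and>
        roe_D P g (h p) (u p) G = L ** \<Lambda> p ** transpose L \<and> T p = roe_R P g (u p) G ** L"
    using eig by (rule eventually_mono) (simp add: roe_eigendecomposition_def)
  \<comment> \<open>The decomposition only asserts existence at each \<open>p\<close>; choosing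
    \<open>G\<close> and \<open>L\<close> pointwise makes them families.\<close>
  then obtain G where "\<forall>\<^sub>F p in F. \<exists>L. pos_def (G p) \<and> G p ** G p = g *\<^sub>R P (h p) \<and> orthogonal_matrix L \<and>
        roe_D P g (h p) (u p) (G p) = L ** \<Lambda> p ** transpose L \<and> T p = roe_R P g (u p) (G p) ** L"
    by (rule eventually_choice)
  then obtain L where GL: "\<forall>\<^sub>F p in F. pos_def (G p) \<and> G p ** G p = g *\<^sub>R P (h p) \<and> orthogonal_matrix (L p) \<and>
        roe_D P g (h p) (u p) (G p) = L p ** \<Lambda> p ** transpose (L p) \<and> T p = roe_R P g (u p) (G p) ** L p"
    by (rule eventually_choice)
  have G: "\<forall>\<^sub>F p in F. pos_def (G p) \<and> G p ** G p = g *\<^sub>R P (h p)"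
    and L: "\<forall>\<^sub>F p in F. orthogonal_matrix (L p)"
    and D: "\<forall>\<^sub>F p in F. roe_D P g (h p) (u p) (G p) = L p ** \<Lambda> p ** transpose (L p)"
    and T: "\<forall>\<^sub>F p in F. T p = roe_R P g (u p) (G p) ** L p"
    using GL by (auto elim: eventually_mono)
  have diag: "\<forall>\<^sub>F p in F. diagonal_mat (\<Lambda> p)"
    using eig by (rule eventually_mono) (simp add: roe_eigendecomposition_def)
  have Pu: "op_bounded F (\<lambda>p. P (u p))" by (rule op_bounded_P[OF u])
  have Pq: "op_bounded F (\<lambda>p. P (P (h p) *v u p))"
    by (rule op_bounded_P[OF Bfun_bilinear[OF bilinear h u]])
  have Gb: "op_bounded F G"
    by (rule op_bounded_sqrt[OF op_bounded_scaleR[OF op_bounded_P[OF h]] G])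
  have Gi: "op_bounded F (\<lambda>p. matrix_inv (G p))"
  proof (rule op_bounded_inv_sqrt[OF _ _ G])
    show "g * \<alpha> > 0" using g \<alpha> by simp
    show "\<forall>\<^sub>F p in F. coercive (g * \<alpha>) (g *\<^sub>R P (h p))"
      using co by (rule eventually_mono)
        (use g in \<open>simp add: coercive_def scaleR_matrix_vector_assoc[symmetric] mult.assoc mult_left_mono\<close>)
  qed
  have R: "op_bounded F (\<lambda>p. roe_R P g (u p) (G p))"
    unfolding roe_R_def
    by (intro op_bounded_scaleR op_bounded_block_mat op_bounded_mat_1 op_bounded_add op_bounded_diff Pu Gb)
  have Db: "op_bounded F (\<lambda>p. roe_D P g (h p) (u p) (G p))"
    unfolding roe_D_def Let_def
    by (intro op_bounded_scaleR op_bounded_block_mat op_bounded_add op_bounded_diff op_bounded_mult Pu Pq Gb Gi)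
  note Lb = op_bounded_orthogonal[OF L]
  have "op_bounded F (\<lambda>p. transpose (L p) ** roe_D P g (h p) (u p) (G p) ** L p)"
    by (intro op_bounded_mult op_bounded_transpose Lb Db)
  moreover have "\<forall>\<^sub>F p in F. transpose (L p) ** roe_D P g (h p) (u p) (G p) ** L p = \<Lambda> p"
    using L D
  proof eventually_elim
    case (elim p)
    have "transpose (L p) ** (L p ** \<Lambda> p ** transpose (L p)) ** L p
        = (transpose (L p) ** L p) ** \<Lambda> p ** (transpose (L p) ** L p)"
      by (simp only: matrix_mul_assoc)
    then show ?case using elim by (simp add: orthogonal_matrix_def)
  qed
  ultimately have "op_bounded F \<Lambda>" by (rule op_bounded_cong)
  then have "op_bounded F (\<lambda>p. abs_mat (\<Lambda> p))" using diag by (rule op_bounded_abs_mat)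
  then have "op_bounded F (\<lambda>p. (roe_R P g (u p) (G p) ** L p) ** abs_mat (\<Lambda> p)
      ** transpose (roe_R P g (u p) (G p) ** L p))"
    by (intro op_bounded_mult op_bounded_transpose R Lb)
  moreover have "\<forall>\<^sub>F p in F. (roe_R P g (u p) (G p) ** L p) ** abs_mat (\<Lambda> p)
      ** transpose (roe_R P g (u p) (G p) ** L p) = T p ** abs_mat (\<Lambda> p) ** transpose (T p)"
    using T by (rule eventually_mono) simp
  ultimately show ?thesis by (rule op_bounded_cong)
qed

lemma close_avg:
  assumes "close a c" "close b c"
  shows "close (\<lambda>p. avg (a p) (b p)) c"
  using close_scaleR[OF close_add[OF assms], of "1/2"] by (simp add: avg_def flip: scaleR_2)

text \<open>Both cells approximate the same state \<open>U p\<close> and bottom \<open>B p\<close>.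
  The conservative flux is therefore consistent, and the jump of the entropy variable is of first
  order, as is its image under the bounded diffusion matrix.\<close>

lemma close_es1_flux:
  fixes a b :: "'p \<Rightarrow> 'k cell"
  assumes g: "g > 0" and \<alpha>: "\<alpha> > 0" and co: "\<forall>\<^sub>F p in F. coercive \<alpha> (P (upper (U p)))"
    and a: "close (\<lambda>p. fst (a p)) U" "close (\<lambda>p. snd (a p)) B"
    and b: "close (\<lambda>p. fst (b p)) U" "close (\<lambda>p. snd (b p)) B"
    and eig: "\<And>a b. pos_def (P (cell_h a)) \<Longrightarrow> pos_def (P (cell_h b)) \<Longrightarrow>
       roe_eigendecomposition P g (avg_h a b) (avg_u P a b) (T a b) (\<Lambda> a b)"
  shows "close (\<lambda>p. es1_flux P g T \<Lambda> (a p) (b p)) (\<lambda>p. sgswe_flux P g (U p))"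
proof -
  let ?h = "\<lambda>p. upper (U p)" and ?q = "\<lambda>p. lower (U p)"
  let ?u = "\<lambda>p. matrix_inv (P (?h p)) *v ?q p"
  have h: "close (\<lambda>p. cell_h (c p)) ?h" and q: "close (\<lambda>p. cell_q (c p)) ?q"
    and u: "close (\<lambda>p. cell_u P (c p)) ?u" and B: "close (\<lambda>p. cell_B (c p)) B"
    and V: "close (\<lambda>p. entropy_var P g (c p)) (\<lambda>p. entropy_var P g (U p, B p))"
    and pd: "\<forall>\<^sub>F p in F. pos_def (P (cell_h (c p)))"
    if c: "close (\<lambda>p. fst (c p)) U" "close (\<lambda>p. snd (c p)) B" for c :: "'p \<Rightarrow> 'k cell"
  proof -
    show h: "close (\<lambda>p. cell_h (c p)) ?h" and q: "close (\<lambda>p. cell_q (c p)) ?q"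
      using close_upper[OF c(1)] close_lower[OF c(1)] by (simp_all add: cell_h_def cell_q_def)
    show u: "close (\<lambda>p. cell_u P (c p)) ?u"
      unfolding cell_u_def by (rule close_matrix_inv[OF \<alpha> co h q])
    show B: "close (\<lambda>p. cell_B (c p)) B" using c(2) by (simp add: cell_B_def)
    have "close (\<lambda>p. entropy_var P g (c p))
        (\<lambda>p. stack (- ((1 / 2) *\<^sub>R (P (?u p) *v ?u p)) + g *\<^sub>R (?h p + B p)) (?u p))"
      unfolding entropy_var_def
      by (rule close_stack[OF close_add[OF close_minus[OF close_scaleR[OF close_prod[OF u u]]]
            close_scaleR[OF close_add[OF h B]]] u])
    then show "close (\<lambda>p. entropy_var P g (c p)) (\<lambda>p. entropy_var P g (U p, B p))"
      by (simp add: entropy_var_def cell_u_def cell_h_def cell_q_def cell_B_def)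
    show "\<forall>\<^sub>F p in F. pos_def (P (cell_h (c p)))"
      using close_coercive[OF \<alpha> co h] by (rule eventually_mono) (use \<alpha> in \<open>auto intro: coercive_pos_def[of "\<alpha> / 2"]\<close>)
  qed
  have ah: "close (\<lambda>p. avg_h (a p) (b p)) ?h" and au: "close (\<lambda>p. avg_u P (a p) (b p)) ?u"
    unfolding avg_h_def avg_u_def by (intro close_avg h u a b)+
  have m: "close (\<lambda>p. P (avg_h (a p) (b p)) *v avg_u P (a p) (b p)) (\<lambda>p. P (?h p) *v ?u p)"
    by (rule close_prod[OF ah au])
  have ec: "close (\<lambda>p. ec_flux P g (a p) (b p))
      (\<lambda>p. stack (P (?h p) *v ?u p) ((g / 2) *\<^sub>R (P (?h p) *v ?h p) + P (?u p) *v (P (?h p) *v ?u p)))"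
    unfolding ec_flux_def
    by (intro close_stack close_add close_scaleR close_avg m close_prod[OF h[OF a] h[OF a]]
        close_prod[OF h[OF b] h[OF b]] close_prod[OF au m])
  have "close (\<lambda>p. jump (entropy_var P g (a p)) (entropy_var P g (b p))) (\<lambda>p. 0)"
    using close_diff[OF V[OF b] V[OF a]] by (simp add: jump_def)
  moreover have "op_bounded F (\<lambda>p. es1_matrix T \<Lambda> (a p) (b p))"
    unfolding es1_matrix_def
  proof (rule op_bounded_es1_matrix[OF g])
    show "\<alpha> / 2 > 0" using \<alpha> by simp
    show "\<forall>\<^sub>F p in F. coercive (\<alpha> / 2) (P (avg_h (a p) (b p)))" by (rule close_coercive[OF \<alpha> co ah])
    show "Bfun (\<lambda>p. avg_h (a p) (b p)) F" by (rule close_Bfun_left[OF ah])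
    show "Bfun (\<lambda>p. avg_u P (a p) (b p)) F" by (rule close_Bfun_left[OF au])
    show "\<forall>\<^sub>F p in F. roe_eigendecomposition P g (avg_h (a p) (b p)) (avg_u P (a p) (b p)) (T (a p) (b p)) (\<Lambda> (a p) (b p))"
      using pd[OF a] pd[OF b] by eventually_elim (rule eig)
  qed
  ultimately have "close (\<lambda>p. es1_matrix T \<Lambda> (a p) (b p) *v jump (entropy_var P g (a p)) (entropy_var P g (b p))) (\<lambda>p. 0)"
    by (intro close_op_bounded_0)
  from close_diff[OF ec close_scaleR[OF this, of "1/2"]]
  have "close (\<lambda>p. es1_flux P g T \<Lambda> (a p) (b p))
      (\<lambda>p. stack (P (?h p) *v ?u p) ((g / 2) *\<^sub>R (P (?h p) *v ?h p) + P (?u p) *v (P (?h p) *v ?u p)))"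
    by (simp add: es1_flux_def)
  then show ?thesis
  proof (rule close_cong)
    \<comment> \<open>Here \<open>P h *v u = q\<close>, and \<open>swap\<close> turns
      \<open>P u *v q\<close> into the \<open>P q *v u\<close> of the physical flux.\<close>
    show "\<forall>\<^sub>F p in F. stack (P (?h p) *v ?u p) ((g / 2) *\<^sub>R (P (?h p) *v ?h p) + P (?u p) *v (P (?h p) *v ?u p))
        = sgswe_flux P g (U p)"
      using co
    proof eventually_elim
      case (elim p)
      have "P (?h p) *v ?u p = ?q p"
        using coercive_pos_def[OF \<alpha> elim] by (simp add: matrix_inv_mult_vec pos_def_invertible)
      then show ?case by (simp add: sgswe_flux_def Let_def swap[of "?u p" "?q p"] add.commute)
    qed
  qed simp
qed

text \<open>The factor \<open>1 / d p\<close> is moved onto the bottom jumps, giving two difference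
  quotients that both approximate \<open>B'\<close>; their sum turns \<open>g / 2\<close> into
  \<open>g\<close>.\<close>

lemma close_num_source:
  fixes a b c :: "'p \<Rightarrow> 'k cell"
  assumes a: "close (\<lambda>p. fst (a p)) U" and b: "close (\<lambda>p. fst (b p)) U" and c: "close (\<lambda>p. fst (c p)) U"
    and jl: "close (\<lambda>p. (1 / d p) *\<^sub>R (snd (b p) - snd (a p))) B'"
    and jr: "close (\<lambda>p. (1 / d p) *\<^sub>R (snd (c p) - snd (b p))) B'"
  shows "close (\<lambda>p. num_source P g (d p) (a p) (b p) (c p)) (\<lambda>p. sgswe_source P g (U p) (B' p))"
proof -
  note [simp] = cell_h_def cell_B_def
  have l: "close (\<lambda>p. avg_h (a p) (b p)) (\<lambda>p. upper (U p))"
    and r: "close (\<lambda>p. avg_h (b p) (c p)) (\<lambda>p. upper (U p))"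
    unfolding avg_h_def cell_h_def by (intro close_avg close_upper a b c)+
  have "close (\<lambda>p. stack 0 (- ((g / 2) *\<^sub>R
        (P (avg_h (b p) (c p)) *v ((1 / d p) *\<^sub>R (snd (c p) - snd (b p)))
         + P (avg_h (a p) (b p)) *v ((1 / d p) *\<^sub>R (snd (b p) - snd (a p)))))))
      (\<lambda>p. stack 0 (- ((g / 2) *\<^sub>R (P (upper (U p)) *v B' p + P (upper (U p)) *v B' p))))"
    by (rule close_stack[OF close_refl[OF Bfun_const] close_minus[OF close_scaleR[OF
        close_add[OF close_prod[OF r jr] close_prod[OF l jl]]]]])
  then show ?thesis
  proof (rule close_cong)
    show "\<forall>\<^sub>F p in F. stack 0 (- ((g / 2) *\<^sub>R
        (P (avg_h (b p) (c p)) *v ((1 / d p) *\<^sub>R (snd (c p) - snd (b p)))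
         + P (avg_h (a p) (b p)) *v ((1 / d p) *\<^sub>R (snd (b p) - snd (a p))))))
        = num_source P g (d p) (a p) (b p) (c p)"
      by (intro always_eventually allI) (simp add: num_source_def jump_def prod.scaleR_right flip: scaleR_add_right)
    show "\<forall>\<^sub>F p in F. stack 0 (- ((g / 2) *\<^sub>R (P (upper (U p)) *v B' p + P (upper (U p)) *v B' p)))
        = sgswe_source P g (U p) (B' p)"
      by (intro always_eventually allI) (simp add: sgswe_source_def flip: scaleR_2)
  qed
qed

end

subsection \<open>Cell averages of smooth functions\<close>

lemma ident_scaleR_has_integral:
  fixes v :: "'a::banach"
  assumes "a \<le> b"
  shows "((\<lambda>t. (t - c) *\<^sub>R v) has_integral ((b - a) * ((a + b) / 2 - c)) *\<^sub>R v) {a..b}"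
proof -
  have "((\<lambda>t. t - c) has_integral (b\<^sup>2 - a\<^sup>2) / 2 - (b - a) * c) {a..b}"
    using has_integral_diff[OF ident_has_integral[OF assms] has_integral_const_real[of c a b]] assms
    by simp
  moreover have "(b\<^sup>2 - a\<^sup>2) / 2 - (b - a) * c = (b - a) * ((a + b) / 2 - c)"
    by (simp add: power2_eq_square field_simps)
  ultimately show ?thesis by (metis has_integral_scaleR_left)
qed

text \<open>The average of an affine function over a cell is its value at the center, so a pointwise
  bound for affine approximation passes to the average.\<close>

lemma cell_average_affine_bound:
  fixes f :: "real \<Rightarrow> real^'n"
  assumes dx: "dx > 0" and f: "continuous_on {x - dx / 2..x + dx / 2} f"
    and e: "\<And>t. t \<in> {x - dx / 2..x + dx / 2} \<Longrightarrow> norm (f t - (v + (t - y) *\<^sub>R w)) \<le> e"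
  shows "norm (cell_average f dx x - (v + (x - y) *\<^sub>R w)) \<le> e"
proof -
  let ?I = "{x - dx / 2..x + dx / 2}" and ?a = "\<lambda>t. v + (t - y) *\<^sub>R w"
  have "(?a has_integral dx *\<^sub>R v + (dx * (x - y)) *\<^sub>R w) ?I"
    using has_integral_add[OF has_integral_const_real[of v "x - dx / 2" "x + dx / 2"]
        ident_scaleR_has_integral[of "x - dx / 2" "x + dx / 2" y w]] dx by simp
  moreover have "(f has_integral integral ?I f) ?I"
    using f by (intro integrable_integral integrable_continuous_real)
  ultimately have diff: "integral ?I (\<lambda>t. f t - ?a t) = integral ?I f - (dx *\<^sub>R v + (dx * (x - y)) *\<^sub>R w)"
    by (intro integral_unique has_integral_diff)
  have "norm (integral ?I (\<lambda>t. f t - ?a t)) \<le> e * ((x + dx / 2) - (x - dx / 2))"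
    using dx by (intro integral_bound e continuous_intros f) auto
  moreover define X where "X = integral ?I f - (dx *\<^sub>R v + (dx * (x - y)) *\<^sub>R w)"
  moreover have "cell_average f dx x - (v + (x - y) *\<^sub>R w) = (1 / dx) *\<^sub>R X"
    using dx by (simp add: X_def cell_average_def scaleR_diff_right scaleR_add_right)
  ultimately show ?thesis using dx by (simp add: diff divide_le_eq)
qed

lemma smooth_fun_on_D:
  assumes "open X" "smooth_fun_on X f"
  obtains f'' where "\<And>x. x \<in> X \<Longrightarrow> (f has_vector_derivative vector_derivative f (at x)) (at x)"
    and "\<And>x. x \<in> X \<Longrightarrow> ((\<lambda>x. vector_derivative f (at x)) has_vector_derivative f'' x) (at x)"
    and "continuous_on X f''"
proof -
  obtain D where D0: "\<And>x. x \<in> X \<Longrightarrow> D (0::nat) x = f x"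
    and D: "\<And>n x. x \<in> X \<Longrightarrow> (D n has_vector_derivative D (Suc n) x) (at x)"
    using assms(2) by (auto simp: smooth_fun_on_def)
  have 1: "(f has_vector_derivative D 1 x) (at x)" if "x \<in> X" for x
    using has_vector_derivative_transform_within_open[OF _ assms(1) that, of "D 0" _ f] D[OF that, of 0] D0 by simp
  then have vd: "vector_derivative f (at x) = D 1 x" if "x \<in> X" for x
    using that by (intro vector_derivative_at)
  show ?thesis
  proof
    show "(f has_vector_derivative vector_derivative f (at x)) (at x)" if "x \<in> X" for x
      using 1[OF that] vd[OF that] by simp
    show "((\<lambda>x. vector_derivative f (at x)) has_vector_derivative D 2 x) (at x)" if "x \<in> X" for x
      using has_vector_derivative_transform_within_open[OF _ assms(1) that, of "D 1" _ "\<lambda>x. vector_derivative f (at x)"]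
        D[OF that, of 1] vd by (simp add: numeral_2_eq_2)
    show "continuous_on X (D 2)"
      using D[of _ 2] by (meson continuous_at_imp_continuous_on has_vector_derivative_continuous)
  qed
qed

text \<open>Second order accuracy is required because the source divides differences of averages by
  the mesh width.\<close>

lemma cell_average_expansion:
  fixes f :: "real \<Rightarrow> real^'n"
  assumes X: "open X" "smooth_fun_on X f" and K: "compact K" "K \<subseteq> X"
  shows "\<exists>\<delta>>0. \<exists>C. \<forall>dx\<in>{0<..<\<delta>}. \<forall>y\<in>K. \<forall>s\<in>{-1..1}.
      norm (cell_average f dx (y + s * dx) - (f y + (s * dx) *\<^sub>R vector_derivative f (at y))) \<le> C * dx\<^sup>2"
proof -
  let ?f' = "\<lambda>x. vector_derivative f (at x)"
  obtain f'' where f': "\<And>x. x \<in> X \<Longrightarrow> (f has_vector_derivative ?f' x) (at x)"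
    and f'': "\<And>x. x \<in> X \<Longrightarrow> (?f' has_vector_derivative f'' x) (at x)"
    and cont: "continuous_on X f''"
    using smooth_fun_on_D[OF X] by blast
  obtain \<epsilon> where \<epsilon>: "\<epsilon> > 0" "(\<Union>x\<in>K. cball x \<epsilon>) \<subseteq> X"
    using compact_subset_open_imp_cball_epsilon_subset[OF K(1) X(1) K(2)] .
  \<comment> \<open>The thickening of \<open>K\<close> is a sum of two compact sets, hence compact,
    so \<open>f''\<close> is bounded on it.\<close>
  have "(\<Union>t\<in>cball 0 \<epsilon>. {x + t}) = cball x \<epsilon>" for x :: real
  proof (intro set_eqI iffI)
    fix z assume "z \<in> cball x \<epsilon>"
    then show "z \<in> (\<Union>t\<in>cball 0 \<epsilon>. {x + t})" by (intro UN_I[of "z - x"]) (auto simp: dist_norm)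
  qed (auto simp: dist_norm)
  then have "compact (\<Union>x\<in>K. cball x \<epsilon>)"
    using compact_sums'[OF K(1) compact_cball[of 0 \<epsilon>]] by simp
  then have "compact (f'' ` (\<Union>x\<in>K. cball x \<epsilon>))"
    using cont \<epsilon>(2) by (intro compact_continuous_image) (rule continuous_on_subset)
  then obtain M where M: "M > 0" "\<And>x y. y \<in> K \<Longrightarrow> x \<in> cball y \<epsilon> \<Longrightarrow> norm (f'' x) \<le> M"
    using compact_imp_bounded bounded_pos by (metis (no_types, lifting) UN_I image_eqI)
  have taylor: "norm (f z - (f y + (z - y) *\<^sub>R ?f' y)) \<le> M * (z - y)\<^sup>2"
    if y: "y \<in> K" and z: "\<bar>z - y\<bar> \<le> \<epsilon>" for y z
  proof -
    let ?S = "closed_segment y z"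
    have "closed_segment y z \<subseteq> cball y \<epsilon>"
      using z \<epsilon>(1) by (intro closed_segment_subset) (auto simp: dist_norm abs_minus_commute)
    then have S: "?S \<subseteq> cball y \<epsilon>" "?S \<subseteq> X" using \<epsilon>(2) y by auto
    have "norm (?f' x - ?f' y) \<le> M * norm (z - y)" if x: "x \<in> ?S" for x
    proof -
      have "norm (?f' x - ?f' y) \<le> M * norm (x - y)"
      proof (rule differentiable_bound[where S = ?S and f' = "\<lambda>t h. h *\<^sub>R f'' t"])
        show "(?f' has_derivative (\<lambda>h. h *\<^sub>R f'' t)) (at t within ?S)" if "t \<in> ?S" for t
          using f''[of t] S that has_vector_derivative_at_within unfolding has_vector_derivative_def[symmetric]
          by blast
        show "onorm (\<lambda>h. h *\<^sub>R f'' t) \<le> M" if "t \<in> ?S" for t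
          using M(2)[OF y, of t] S that by (intro onorm_le) (simp add: subset_iff mult.commute[of "\<bar>_\<bar>" "norm _"] mult_right_mono)
      qed (use x in auto)
      also have "\<dots> \<le> M * norm (z - y)"
        using segment_bound(1)[OF x] M(1) by (simp add: mult_left_mono)
      finally show ?thesis .
    qed
    then have "norm (f z - f y - (z - y) *\<^sub>R ?f' y) \<le> norm (z - y) * (M * norm (z - y))"
      using f' S by (intro vector_differentiable_bound_linearization[where S = ?S])
        (auto intro!: has_vector_derivative_at_within[OF f'])
    then show ?thesis by (simp add: power2_eq_square diff_diff_eq mult_ac)
  qed
  show ?thesis
  \<comment> \<open>With the center within \<open>dx\<close> of \<open>y\<close>, points of the cell
    lie within \<open>3 / 2 * dx\<close> of \<open>y\<close>: below \<open>\<epsilon>\<close> when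
    \<open>dx < \<epsilon> / 2\<close>, and the source of the factor \<open>9 / 4\<close>.\<close>
  proof (rule exI[of _ "\<epsilon> / 2"], intro exI[of _ "M * (9 / 4)"] conjI ballI)
    show "\<epsilon> / 2 > 0" using \<epsilon>(1) by simp
    fix dx y s :: real
    assume "dx \<in> {0<..<\<epsilon> / 2}" and y: "y \<in> K" and "s \<in> {-1..1}"
    then have dx: "0 < dx" "dx < \<epsilon> / 2" and s: "\<bar>s\<bar> \<le> 1" by auto
    let ?x = "y + s * dx"
    let ?I = "{?x - dx / 2..?x + dx / 2}"
    have "\<bar>s * dx\<bar> \<le> dx" using s dx(1) by (simp add: abs_mult)
    then have I: "\<bar>t - y\<bar> \<le> 3 / 2 * dx" if "t \<in> ?I" for t using that unfolding atLeastAtMost_iff by argo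
    then have I\<epsilon>: "\<bar>t - y\<bar> \<le> \<epsilon>" if "t \<in> ?I" for t using I[OF that] dx by argo
    have "?I \<subseteq> X" using \<epsilon>(2) y I\<epsilon> by (force simp: dist_norm abs_minus_commute)
    then have "continuous_on ?I f"
      using f' by (meson continuous_at_imp_continuous_on has_vector_derivative_continuous subsetD)
    moreover have "norm (f t - (f y + (t - y) *\<^sub>R ?f' y)) \<le> M * (9 / 4) * dx\<^sup>2" if "t \<in> ?I" for t
    proof -
      have "M * (t - y)\<^sup>2 \<le> M * (3 / 2 * dx)\<^sup>2"
        using power_mono[OF I[OF that], of 2] M(1) by (intro mult_left_mono) auto
      then show ?thesis using taylor[OF y I\<epsilon>[OF that]] by (simp add: power2_eq_square)
    qed
    ultimately show "norm (cell_average f dx ?x - (f y + (s * dx) *\<^sub>R ?f' y)) \<le> M * (9 / 4) * dx\<^sup>2"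
      using cell_average_affine_bound[OF dx(1), of ?x f "f y" y "?f' y"] unfolding add_diff_cancel_left' by blast
  qed
qed

text \<open>The filter lives on pairs of a mesh width and a position, and expresses limits for vanishing mesh
  width that are uniform over the positions in \<open>K\<close>.\<close>

definition mesh_filter :: "real set \<Rightarrow> (real \<times> real) filter" where
  "mesh_filter K = at_right 0 \<times>\<^sub>F principal K"

lemma eventually_mesh_filter:
  "eventually Q (mesh_filter K) \<longleftrightarrow> (\<forall>\<^sub>F dx in at_right 0. \<forall>y\<in>K. Q (dx, y))"
proof
  assume "eventually Q (mesh_filter K)"
  then obtain A B where "eventually A (at_right 0)" "\<forall>y\<in>K. B y" "\<And>x y. A x \<Longrightarrow> B y \<Longrightarrow> Q (x, y)"
    by (auto simp: mesh_filter_def eventually_prod_filter eventually_principal)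
  then show "\<forall>\<^sub>F dx in at_right 0. \<forall>y\<in>K. Q (dx, y)" by (auto elim: eventually_mono)
next
  assume "\<forall>\<^sub>F dx in at_right 0. \<forall>y\<in>K. Q (dx, y)"
  then show "eventually Q (mesh_filter K)"
    unfolding mesh_filter_def eventually_prod_filter eventually_principal
    by (intro exI[of _ "\<lambda>dx. \<forall>y\<in>K. Q (dx, y)"] exI[of _ "\<lambda>y. y \<in> K"]) auto
qed

interpretation mesh: small_parameter "mesh_filter K" fst for K
proof
  show "(fst \<longlongrightarrow> 0) (mesh_filter K)"
    unfolding mesh_filter_def by (rule filterlim_compose[OF tendsto_ident_at filterlim_fst])
  show "\<forall>\<^sub>F p in mesh_filter K. 0 \<le> fst p"
    unfolding eventually_mesh_filter by (simp add: eventually_at_filter)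
qed

lemma Bfun_mesh_filter:
  fixes f :: "real \<Rightarrow> 'a::real_normed_vector"
  assumes "compact K" "continuous_on K f"
  shows "Bfun (\<lambda>p. f (snd p)) (mesh_filter K)"
proof -
  obtain M where "\<And>y. y \<in> K \<Longrightarrow> norm (f y) \<le> M"
    using compact_imp_bounded[OF compact_continuous_image[OF assms(2,1)]] by (auto simp: bounded_iff)
  then show ?thesis by (intro BfunI[of _ M]) (simp add: eventually_mesh_filter)
qed

text \<open>Both claims compare with the expansion at \<open>snd p\<close>. For the jump,
  consecutive cells share the constant term, and their linear terms differ by exactly the mesh width
  times the derivative.\<close>

lemma
  fixes f :: "real \<Rightarrow> real^'n"
  assumes X: "open X" "smooth_fun_on X f" and K: "compact K" "K \<subseteq> X"
  shows close_cell_average: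
      "\<bar>s\<bar> \<le> 1 \<Longrightarrow> mesh.close K (\<lambda>p. cell_average f (fst p) (snd p + s * fst p)) (\<lambda>p. f (snd p))"
    and close_cell_average_jump:
      "\<bar>s\<bar> \<le> 1 \<Longrightarrow> \<bar>s + 1\<bar> \<le> 1 \<Longrightarrow>
        mesh.close K (\<lambda>p. (1 / fst p) *\<^sub>R (cell_average f (fst p) (snd p + (s + 1) * fst p)
            - cell_average f (fst p) (snd p + s * fst p)))
          (\<lambda>p. vector_derivative f (at (snd p)))"
proof -
  let ?f' = "\<lambda>x. vector_derivative f (at x)"
  obtain f'' where f': "\<And>x. x \<in> X \<Longrightarrow> (f has_vector_derivative ?f' x) (at x)"
    and f'': "\<And>x. x \<in> X \<Longrightarrow> (?f' has_vector_derivative f'' x) (at x)"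
    using smooth_fun_on_D[OF X] by blast
  have cont: "continuous_on K f" "continuous_on K ?f'"
    using f' f'' K(2) by (meson continuous_at_imp_continuous_on has_vector_derivative_continuous subsetD)+
  obtain \<delta> C where \<delta>: "\<delta> > 0" and C_all: "\<forall>dx\<in>{0<..<\<delta>}. \<forall>y\<in>K. \<forall>s\<in>{-1..1}.
      norm (cell_average f dx (y + s * dx) - (f y + (s * dx) *\<^sub>R ?f' y)) \<le> C * dx\<^sup>2"
    using cell_average_expansion[OF X K] by blast
  have C: "norm (cell_average f dx (y + s * dx) - (f y + (s * dx) *\<^sub>R ?f' y)) \<le> C * dx\<^sup>2"
    if "0 < dx" "dx < \<delta>" "y \<in> K" "\<bar>s\<bar> \<le> 1" for dx y s
    using C_all that by (simp add: abs_le_iff)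
  \<comment> \<open>The bound 1 makes \<open>dx\<^sup>2\<close> at most \<open>dx\<close>.\<close>
  have small: "\<forall>\<^sub>F dx in at_right 0. 0 < dx \<and> dx < min \<delta> 1"
    using \<delta> eventually_at_right_real[of 0 "min \<delta> 1"] by (auto elim: eventually_mono)
  obtain M where M: "\<And>y. y \<in> K \<Longrightarrow> norm (?f' y) \<le> M"
    using compact_imp_bounded[OF compact_continuous_image[OF cont(2) K(1)]] by (auto simp: bounded_iff)
  show "mesh.close K (\<lambda>p. cell_average f (fst p) (snd p + s * fst p)) (\<lambda>p. f (snd p))" if s: "\<bar>s\<bar> \<le> 1"
  proof (rule mesh.closeI)
    show "\<forall>\<^sub>F p in mesh_filter K. norm (cell_average f (fst p) (snd p + s * fst p) - f (snd p)) \<le> (\<bar>C\<bar> + M) * fst p"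
      unfolding eventually_mesh_filter fst_conv snd_conv
      using small
    proof (eventually_elim, intro ballI)
      fix dx y assume dx: "0 < dx \<and> dx < min \<delta> 1" and y: "y \<in> K"
      let ?a = "cell_average f dx (y + s * dx)"
      have "norm (?a - f y) \<le> norm (?a - (f y + (s * dx) *\<^sub>R ?f' y)) + norm ((s * dx) *\<^sub>R ?f' y)"
        using norm_triangle_ineq[of "?a - (f y + (s * dx) *\<^sub>R ?f' y)" "(s * dx) *\<^sub>R ?f' y"] by simp
      also have "\<dots> \<le> \<bar>C\<bar> * dx + M * dx"
      proof (rule add_mono)
        have "C * dx\<^sup>2 \<le> \<bar>C\<bar> * dx\<^sup>2" by (intro mult_right_mono) auto
        also have "dx\<^sup>2 \<le> dx" using dx by (simp add: power2_eq_square mult_left_le)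
        finally show "norm (?a - (f y + (s * dx) *\<^sub>R ?f' y)) \<le> \<bar>C\<bar> * dx"
          using C[of dx y s] dx y s by (simp add: mult_left_mono)
        have "\<bar>s\<bar> * dx * norm (?f' y) \<le> 1 * dx * M"
          using s dx M[OF y] by (intro mult_mono) auto
        then show "norm ((s * dx) *\<^sub>R ?f' y) \<le> M * dx" using dx by (simp add: abs_mult mult_ac)
      qed
      finally show "norm (?a - f y) \<le> (\<bar>C\<bar> + M) * dx" by (simp add: distrib_right)
    qed
  qed (rule Bfun_mesh_filter[OF K(1) cont(1)])
  show "mesh.close K (\<lambda>p. (1 / fst p) *\<^sub>R (cell_average f (fst p) (snd p + (s + 1) * fst p)
            - cell_average f (fst p) (snd p + s * fst p))) (\<lambda>p. ?f' (snd p))"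
    if s: "\<bar>s\<bar> \<le> 1" "\<bar>s + 1\<bar> \<le> 1"
  proof (rule mesh.closeI)
    show "\<forall>\<^sub>F p in mesh_filter K. norm ((1 / fst p) *\<^sub>R (cell_average f (fst p) (snd p + (s + 1) * fst p)
        - cell_average f (fst p) (snd p + s * fst p)) - ?f' (snd p)) \<le> (2 * C) * fst p"
      unfolding eventually_mesh_filter fst_conv snd_conv
      using small
    proof (eventually_elim, intro ballI)
      fix dx y assume dx: "0 < dx \<and> dx < min \<delta> 1" and y: "y \<in> K"
      let ?e = "\<lambda>s. cell_average f dx (y + s * dx) - (f y + (s * dx) *\<^sub>R ?f' y)"
      let ?D = "cell_average f dx (y + (s + 1) * dx) - cell_average f dx (y + s * dx)"
      have "?e (s + 1) - ?e s = ?D - dx *\<^sub>R ?f' y" by (simp add: algebra_simps)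
      then have "norm (?D - dx *\<^sub>R ?f' y) \<le> norm (?e (s + 1)) + norm (?e s)"
        by (metis norm_triangle_ineq4)
      also have "\<dots> \<le> C * dx\<^sup>2 + C * dx\<^sup>2"
        using dx y s by (intro add_mono C) auto
      finally have "norm (?D - dx *\<^sub>R ?f' y) \<le> (2 * C * dx) * dx" by (simp add: power2_eq_square)
      moreover have "(1 / dx) *\<^sub>R ?D - ?f' y = (1 / dx) *\<^sub>R (?D - dx *\<^sub>R ?f' y)"
        using dx by (simp add: scaleR_diff_right)
      ultimately show "norm ((1 / dx) *\<^sub>R ?D - ?f' y) \<le> (2 * C) * dx"
        using dx by (simp add: divide_le_eq)
    qed
  qed (rule Bfun_mesh_filter[OF K(1) cont(2)])
qed

subsection \<open>First order accuracy\<close>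

lemma continuous_on_quadratic_form:
  fixes P :: "real^'k::finite \<Rightarrow> real^'k^'k"
  assumes "bounded_bilinear (\<lambda>a b. P a *v b)" "continuous_on K h"
  shows "continuous_on (K \<times> S) (\<lambda>p. snd p \<bullet> (P (h (fst p)) *v snd p))"
proof -
  interpret bounded_bilinear "\<lambda>a b. P a *v b" by fact
  have "continuous_on (K \<times> S) (\<lambda>p. h (fst p))"
    by (rule continuous_on_compose2[OF assms(2) continuous_on_fst[OF continuous_on_id]]) auto
  then show ?thesis by (intro continuous_intros continuous_on)
qed

context sg_matrix
begin

text \<open>The constant is the minimum of the quadratic form over \<open>K\<close> times the unit
  sphere, attained by compactness and hence positive; homogeneity extends the bound to all
  vectors.\<close>

lemma uniformly_coercive:
  assumes K: "compact K" and h: "continuous_on K h" and pd: "\<And>y. y \<in> K \<Longrightarrow> pos_def (P (h y))"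
  obtains \<alpha> where "\<alpha> > 0" "\<And>y. y \<in> K \<Longrightarrow> coercive \<alpha> (P (h y))"
proof (cases "K = {}")
  case True
  then show ?thesis using that[of 1] by simp
next
  case False
  let ?f = "\<lambda>p. snd p \<bullet> (P (h (fst p)) *v snd p)" and ?S = "sphere 0 1 :: (real^'k) set"
  have "axis undefined 1 \<in> ?S" by (simp add: dist_norm)
  then have ne: "K \<times> ?S \<noteq> {}" using False by auto
  have "compact (K \<times> ?S)" using K by (intro compact_Times) auto
  then obtain m where m: "m \<in> K \<times> ?S" "\<And>p. p \<in> K \<times> ?S \<Longrightarrow> ?f m \<le> ?f p"
    using continuous_attains_inf[OF _ ne continuous_on_quadratic_form[OF bilinear h]] by blast
  show ?thesis
  proof (rule that[of "?f m"])
    have "snd m \<noteq> 0" "fst m \<in> K" using m(1) by (auto simp: dist_norm)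
    then show "?f m > 0" using pd by (auto simp: pos_def_def)
    fix y assume y: "y \<in> K"
    have "?f m * (norm x)\<^sup>2 \<le> x \<bullet> (P (h y) *v x)" for x
    proof (cases "x = 0")
      case False
      have "?f m \<le> ?f (y, x /\<^sub>R norm x)" using y False by (intro m(2)) (auto simp: dist_norm)
      then have "?f m \<le> (x \<bullet> (P (h y) *v x)) / (norm x)\<^sup>2"
        by (simp add: prod.scaleR_right power2_eq_square divide_inverse mult_ac)
      then show ?thesis using False by (simp add: le_divide_eq)
    qed simp
    then show "coercive (?f m) (P (h y))" by (simp add: coercive_def)
  qed
qed

lemma first_order_es1:
  assumes g: "g > 0"
    and eig: "\<And>a b. pos_def (P (cell_h a)) \<Longrightarrow> pos_def (P (cell_h b)) \<Longrightarrow>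
       roe_eigendecomposition P g (avg_h a b) (avg_u P a b) (T a b) (\<Lambda> a b)"
  shows "first_order P g (es1_flux P g T \<Lambda>) (num_source P g)"
  unfolding first_order_def
proof (intro allI impI, elim conjE)
  fix X K :: "real set" and U :: "real \<Rightarrow> real^('k + 'k)" and B :: "real \<Rightarrow> real^'k"
  assume X: "open X" and U: "smooth_fun_on X U" and B: "smooth_fun_on X B"
    and pd: "\<forall>x\<in>X. pos_def (P (upper (U x)))" and K: "compact K" "K \<subseteq> X"
  interpret sp: sg_small_parameter P "mesh_filter K" fst ..
  let ?c = "\<lambda>s p. (cell_average U (fst p) (snd p + s * fst p), cell_average B (fst p) (snd p + s * fst p))"
  let ?F = "es1_flux P g T \<Lambda>" and ?S = "num_source P g" and ?B' = "\<lambda>p. vector_derivative B (at (snd p))"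
  have "continuous_on K U"
    using smooth_fun_on_D[OF X U] K(2)
    by (meson continuous_at_imp_continuous_on has_vector_derivative_continuous subsetD)
  then have "continuous_on K (\<lambda>y. upper (U y))"
    by (rule bounded_linear.continuous_on[OF bounded_linear_upper])
  then obtain \<alpha> where \<alpha>: "\<alpha> > 0" "\<And>y. y \<in> K \<Longrightarrow> coercive \<alpha> (P (upper (U y)))"
    using uniformly_coercive[OF K(1)] pd K(2) by blast
  have co: "\<forall>\<^sub>F p in mesh_filter K. coercive \<alpha> (P (upper (U (snd p))))"
    using \<alpha>(2) by (simp add: eventually_mesh_filter)
  have cU: "mesh.close K (\<lambda>p. fst (?c s p)) (\<lambda>p. U (snd p))" if "\<bar>s\<bar> \<le> 1" for s
    using close_cell_average[OF X U K that] by simp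
  have cB: "mesh.close K (\<lambda>p. snd (?c s p)) (\<lambda>p. B (snd p))" if "\<bar>s\<bar> \<le> 1" for s
    using close_cell_average[OF X B K that] by simp
  \<comment> \<open>For the flux the reference point is the interface, so the adjacent cell centers
    have offsets -1/2 and 1/2; for the source it is the center of the middle cell, with offsets -1,
    0 and 1.\<close>
  have "mesh.close K (\<lambda>p. ?F (?c (- 1 / 2) p) (?c (1 / 2) p)) (\<lambda>p. sgswe_flux P g (U (snd p)))"
    by (rule sp.close_es1_flux[OF g \<alpha>(1) co cU cB cU cB eig]) simp_all
  then obtain C1 where C1: "C1 \<ge> 0" "\<forall>\<^sub>F p in mesh_filter K.
      norm (?F (?c (- 1 / 2) p) (?c (1 / 2) p) - sgswe_flux P g (U (snd p))) \<le> C1 * fst p"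
    by (rule mesh.closeE)
  have "mesh.close K (\<lambda>p. ?S (fst p) (?c (- 1) p) (?c 0 p) (?c 1 p)) (\<lambda>p. sgswe_source P g (U (snd p)) (?B' p))"
  proof (rule sp.close_num_source[OF cU cU cU])
    show "mesh.close K (\<lambda>p. (1 / fst p) *\<^sub>R (snd (?c 0 p) - snd (?c (- 1) p))) ?B'"
      using close_cell_average_jump[OF X B K, of "-1"] by simp
    show "mesh.close K (\<lambda>p. (1 / fst p) *\<^sub>R (snd (?c 1 p) - snd (?c 0 p))) ?B'"
      using close_cell_average_jump[OF X B K, of 0] by simp
  qed simp_all
  then obtain C2 where C2: "C2 \<ge> 0" "\<forall>\<^sub>F p in mesh_filter K.
      norm (?S (fst p) (?c (- 1) p) (?c 0 p) (?c 1 p) - sgswe_source P g (U (snd p)) (?B' p)) \<le> C2 * fst p"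
    by (rule mesh.closeE)
  have "\<forall>\<^sub>F dx in at_right 0. (dx::real) > 0" by (simp add: eventually_at_filter)
  with C1(2)[unfolded eventually_mesh_filter] C2(2)[unfolded eventually_mesh_filter]
  have "\<forall>\<^sub>F dx in at_right 0. \<forall>(x0::real) (i::int).
      let x = (\<lambda>s. x0 + s * dx);
          c = (\<lambda>j. (cell_average U dx (x (of_int j)), cell_average B dx (x (of_int j))));
          xi = x (of_int i); xh = x (of_int i + 1 / 2)
      in (xh \<in> K \<longrightarrow> norm (?F (c i) (c (i + 1)) - sgswe_flux P g (U xh)) \<le> (C1 + C2) * dx) \<and>
         (xi \<in> K \<longrightarrow> norm (?S dx (c (i - 1)) (c i) (c (i + 1))
             - sgswe_source P g (U xi) (vector_derivative B (at xi))) \<le> (C1 + C2) * dx)"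
  proof eventually_elim
    case (elim dx)
    have le: "C1 * dx \<le> (C1 + C2) * dx" "C2 * dx \<le> (C1 + C2) * dx"
      using elim(3) C1(1) C2(1) by (simp_all add: mult_right_mono)
    have F: "norm (?F (?c (- 1 / 2) (dx, y)) (?c (1 / 2) (dx, y)) - sgswe_flux P g (U y)) \<le> (C1 + C2) * dx"
      if "y \<in> K" for y
      using order_trans[OF bspec[OF elim(1) that, unfolded fst_conv snd_conv] le(1)] by simp
    have S: "norm (?S dx (?c (- 1) (dx, y)) (?c 0 (dx, y)) (?c 1 (dx, y))
        - sgswe_source P g (U y) (vector_derivative B (at y))) \<le> (C1 + C2) * dx"
      if "y \<in> K" for y
      using order_trans[OF bspec[OF elim(2) that, unfolded fst_conv snd_conv] le(2)] by simp
    \<comment> \<open>Identifies offsets from the reference point with the mesh positions in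
      \<open>first_order\<close>.\<close>
    have shift: "x0 + (of_int i + 1 / 2) * dx + (- 1 / 2) * dx = x0 + of_int i * dx"
      "x0 + (of_int i + 1 / 2) * dx + (1 / 2) * dx = x0 + of_int (i + 1) * dx"
      "x0 + of_int i * dx + (- 1) * dx = x0 + of_int (i - 1) * dx"
      "x0 + of_int i * dx + 0 * dx = x0 + of_int i * dx"
      "x0 + of_int i * dx + 1 * dx = x0 + of_int (i + 1) * dx" for x0 and i :: int
      by (simp_all add: algebra_simps)
    show ?case
      unfolding Let_def
      using F[of "x0 + (of_int i + 1 / 2) * dx" for x0 i, unfolded fst_conv snd_conv shift]
        S[of "x0 + of_int i * dx" for x0 i, unfolded fst_conv snd_conv shift]
      by blast
  qed
  then show "\<exists>C. \<forall>\<^sub>F \<Delta>x in at_right 0. \<forall>(x0::real) (i::int).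
      let x = (\<lambda>s. x0 + s * \<Delta>x);
          c = (\<lambda>j. (cell_average U \<Delta>x (x (of_int j)), cell_average B \<Delta>x (x (of_int j))));
          xi = x (of_int i); xh = x (of_int i + 1 / 2)
      in (xh \<in> K \<longrightarrow> norm (?F (c i) (c (i + 1)) - sgswe_flux P g (U xh)) \<le> C * \<Delta>x) \<and>
         (xi \<in> K \<longrightarrow> norm (?S \<Delta>x (c (i - 1)) (c i) (c (i + 1))
             - sgswe_source P g (U xi) (vector_derivative B (at xi))) \<le> C * \<Delta>x)"
    by blast
qed

end

section \<open>Application to the polynomial chaos matrices\<close>

lemma sg_matrix_chaos_mat: "sg_matrix (chaos_mat \<rho> \<phi>)"
  by (rule sg_matrix.intro) (rule bounded_bilinear_chaos chaos_mat_swap chaos_mat_transpose)+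

theorem theorem4p2:
  fixes M :: "'w measure" and \<xi> :: "'w \<Rightarrow> real^'d" and \<rho> :: "real^'d \<Rightarrow> real"
    and \<phi> :: "'k::finite \<Rightarrow> real^'d \<Rightarrow> real" and k1 :: 'k and g :: real
    and P :: "real^'k \<Rightarrow> real^'k^'k"
    and T \<Lambda> :: "'k cell \<Rightarrow> 'k cell \<Rightarrow> real^('k + 'k)^('k + 'k)"
  assumes chaos: "polynomial_chaos M \<xi> \<rho> \<phi> k1"
    and P_def: "P = chaos_mat \<rho> \<phi>"
    and g: "g > 0"
    and eig: "\<And>a b. pos_def (P (cell_h a)) \<Longrightarrow> pos_def (P (cell_h b)) \<Longrightarrow>
       roe_eigendecomposition P g (avg_h a b) (avg_u P a b) (T a b) (\<Lambda> a b)"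
  shows "first_order P g (es1_flux P g T \<Lambda>) (num_source P g)
       \<and> well_balanced P (es1_flux P g T \<Lambda>) (num_source P g)
       \<and> energy_stable P g (es1_flux P g T \<Lambda>) (num_source P g)"
proof -
  interpret sg_matrix P unfolding P_def by (rule sg_matrix_chaos_mat)
  have "diagonal_mat (\<Lambda> a b)" if "pos_def (P (cell_h a))" "pos_def (P (cell_h b))" for a b
    using eig[OF that] by (simp add: roe_eigendecomposition_def)
  then show ?thesis
    using first_order_es1[OF g eig] well_balanced_es1 energy_stable_es1 by blast
qed

end
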